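(* Let $L:\mathbb{T}\times\mathbb{R}^n\times\mathbb{R}^n\to\mathbb{R}$, $(t,w,v)\mapsto L(t,w,v)$, be such that $(w,v)\mapsto L(t,w,v)$ is of class $C^2$ for each $t\in\mathbb{T}$. Suppose $y_\ast\in C^1_{rd}[\mathbb{T}]$ is a weak local minimizer of $$\mathcal{L}[y(\cdot)]=\int_a^b L(t,y^\sigma(t),y^\Delta(t))\,\Delta t,\qquad (y(a)=y_a),\ (y(b)=y_b),$$ where each of the two endpoint conditions in parentheses may or may not be present. Then the Euler-Lagrange equation $$L_{y^\Delta}^{\Delta}(t,y_\ast^\sigma(t),y_\ast^\Delta(t))=L_{y^\sigma}(t,y_\ast^\sigma(t),y_\ast^\Delta(t)),\qquad t\in\mathbb{T}^{k^2},$$ holds, where the left-hand side is the delta derivative at $t$ of the function $t\mapsto L_{y^\Delta}(t,y_\ast^\sigma(t),y_\ast^\Delta(t))$. If $y(a)$ is free (the condition $y(a)=y_a$ is not present), then $$L_{y^\Delta}(a,y_\ast^\sigma(a),y_\ast^\Delta(a))=0;$$ if $y(b)$ is free (the condition $y(b)=y_b$ is not present), then $$L_{y^\sigma}(\rho(b),y_\ast^\sigma(\rho(b)),y_\ast^\Delta(\rho(b)))\,\mu(\rho(b))+L_{y^\Delta}(\rho(b),y_\ast^\sigma(\rho(b)),y_\ast^\Delta(\rho(b)))=0 .$$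
   Context: A time scale is a nonempty closed subset of $\mathbb{R}$. Throughout $\mathbb{T}=[a,b]\cap\mathbb{T}_0$ with $a<b$ and $\mathbb{T}_0$ a time scale, where $a=\min\mathbb{T}$ and $b=\max\mathbb{T}$; it is assumed that $\mathbb{T}$ has at least 3 points. The forward jump operator is $\sigma(t)=\inf\{s\in\mathbb{T}:s>t\}$ (with $\sigma(b)=b$), the backward jump operator is $\rho(t)=\sup\{s\in\mathbb{T}:s<t\}$ (with $\rho(a)=a$), and the graininess is $\mu(t)=\sigma(t)-t$. A point $t$ is right-dense if $\sigma(t)=t$, left-dense if $\rho(t)=t$. $\mathbb{T}^k=\mathbb{T}\setminus(\rho(b),b]$ and $\mathbb{T}^{k^2}=(\mathbb{T}^k)^k$. We write $f^\sigma=f\circ\sigma$. A function $f$ on $\mathbb{T}$ is delta differentiable at $t\in\mathbb{T}^k$ with delta derivative $f^\Delta(t)$ if for all $\varepsilon>0$ there is a neighborhood $U=(t-\delta,t+\delta)\cap\mathbb{T}$ with $|f(\sigma(t))-f(s)-f^\Delta(t)(\sigma(t)-s)|\le\varepsilon|\sigma(t)-s|$ for all $s\in U$ (similarly for functions on $\mathbb{T}^k$ at points of $\mathbb{T}^{k^2}$). A function is rd-continuous if it is continuous at right-dense points and its left-sided limit exists at left-dense points. $C^1_{rd}[\mathbb{T}]$ is the set of (here $\mathbb{R}^n$-valued) delta differentiable functions on $\mathbb{T}$ with rd-continuous delta derivative on $\mathbb{T}^k$. The delta integral is $\int_c^d f(t)\Delta t=F(d)-F(c)$ where $F^\Delta=f$.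 $L_{y^\sigma}$ and $L_{y^\Delta}$ denote the partial derivatives (gradients) of $L(t,w,v)$ with respect to the second argument $w$ and the third argument $v$, respectively. $y_\ast\in C^1_{rd}[\mathbb{T}]$ is a weak local minimizer if it satisfies the boundary conditions present and there is $\delta>0$ such that $\mathcal{L}[y_\ast]\le\mathcal{L}[y]$ for all $y\in C^1_{rd}[\mathbb{T}]$ satisfying the boundary conditions present and $\|y-y_\ast\|_{1,\infty}<\delta$, where $\|y\|_{1,\infty}=\sup_{t\in\mathbb{T}^k}|y(t)|+\sup_{t\in\mathbb{T}^k}|y^\Delta(t)|$.
   Formalization: Added: the gradients of L in w and v are rd-continuous jointly in (t,w,v), without which the claim is false; and the Euler–Lagrange equation is asserted only where σ(t) lies in T^k, excluding t=ρ(b) when b is left-scattered and ρ(b) left-dense, as the left side is undefined there. *)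

theory Defs
  imports "HOL-Analysis.Analysis"
begin

definition time_scale :: "real set \<Rightarrow> bool" where
  "time_scale T \<longleftrightarrow> closed T \<and> T \<noteq> {}"

(* The else-branches give the conventions sigma(max T) = max T and rho(min T) = min T. *)

definition fwd_jump :: "real set \<Rightarrow> real \<Rightarrow> real" where
  "fwd_jump T t = (if \<exists>s\<in>T. t < s then Inf {s\<in>T. t < s} else t)"

definition bwd_jump :: "real set \<Rightarrow> real \<Rightarrow> real" where
  "bwd_jump T t = (if \<exists>s\<in>T. s < t then Sup {s\<in>T. s < t} else t)"

definition graininess :: "real set \<Rightarrow> real \<Rightarrow> real" where
  "graininess T t = fwd_jump T t - t"

definition right_dense :: "real set \<Rightarrow> real \<Rightarrow> bool" where
  "right_dense T t \<longleftrightarrow> fwd_jump T t = t"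

definition left_dense :: "real set \<Rightarrow> real \<Rightarrow> bool" where
  "left_dense T t \<longleftrightarrow> bwd_jump T t = t"

definition kappa :: "real set \<Rightarrow> real set" where
  "kappa T = T - {bwd_jump T (Sup T) <.. Sup T}"

definition has_delta_deriv ::
  "real set \<Rightarrow> (real \<Rightarrow> 'a::real_normed_vector) \<Rightarrow> 'a \<Rightarrow> real \<Rightarrow> bool" where
  "has_delta_deriv T f D t \<longleftrightarrow>
     (\<forall>\<epsilon>>0. \<exists>\<delta>>0. \<forall>s \<in> {t - \<delta><..<t + \<delta>} \<inter> T.
        norm (f (fwd_jump T t) - f s - (fwd_jump T t - s) *\<^sub>R D)
          \<le> \<epsilon> * \<bar>fwd_jump T t - s\<bar>)"

(* Meaningful for t in kappa T only: at an isolated maximum of T every D is a derivative. *)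
definition delta_deriv ::
  "real set \<Rightarrow> (real \<Rightarrow> 'a::real_normed_vector) \<Rightarrow> real \<Rightarrow> 'a" where
  "delta_deriv T f t = (THE D. has_delta_deriv T f D t)"

(* For functions defined on a subset S of T, such as kappa T. Density of points refers
   to T, so that rho(max T) counts as right-scattered if max T is isolated in T, even though
   it is the last point of kappa T. The left-sided limit at min T is vacuous. *)
definition rd_continuous_on ::
  "real set \<Rightarrow> real set \<Rightarrow> (real \<Rightarrow> 'a::real_normed_vector) \<Rightarrow> bool" where
  "rd_continuous_on T S f \<longleftrightarrow>
     (\<forall>t\<in>S. (right_dense T t \<longrightarrow> continuous (at t within S) f) \<and>
            (left_dense T t \<longrightarrow> (\<exists>l. (f \<longlongrightarrow> l) (at t within (S \<inter> {..<t})))))"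

(* Rd-continuity of (t,w,v) \<mapsto> g t w v in all variables jointly. It makes t \<mapsto> g t (w t) (v t)
   rd-continuous for all rd-continuous w and v. *)
definition jointly_rd_continuous ::
  "real set \<Rightarrow> (real \<Rightarrow> 'a::real_normed_vector \<Rightarrow> 'a \<Rightarrow> 'b::real_normed_vector) \<Rightarrow> bool" where
  "jointly_rd_continuous T g \<longleftrightarrow>
     (\<forall>t\<in>T. \<forall>w v.
        (right_dense T t \<longrightarrow>
           continuous (at (t, w, v) within (T \<times> UNIV)) (\<lambda>(t, w, v). g t w v)) \<and>
        (left_dense T t \<longrightarrow>
           (\<exists>l. ((\<lambda>(t, w, v). g t w v) \<longlongrightarrow> l)
                  (at (t, w, v) within ((T \<inter> {..<t}) \<times> UNIV)))))"

definition C1_rd :: "real set \<Rightarrow> (real \<Rightarrow> 'a::real_normed_vector) set" where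
  "C1_rd T = {y. (\<forall>t\<in>kappa T. \<exists>D. has_delta_deriv T y D t) \<and>
                 rd_continuous_on T (kappa T) (delta_deriv T y)}"

definition has_delta_integral ::
  "real set \<Rightarrow> (real \<Rightarrow> real) \<Rightarrow> real \<Rightarrow> real \<Rightarrow> real \<Rightarrow> bool" where
  "has_delta_integral T f c d I \<longleftrightarrow>
     (\<exists>F. (\<forall>t\<in>kappa T. has_delta_deriv T F (f t) t) \<and> I = F d - F c)"

definition delta_integral ::
  "real set \<Rightarrow> (real \<Rightarrow> real) \<Rightarrow> real \<Rightarrow> real \<Rightarrow> real" where
  "delta_integral T f c d = (THE I. has_delta_integral T f c d I)"

definition C1_rd_norm :: "real set \<Rightarrow> (real \<Rightarrow> 'a::real_normed_vector) \<Rightarrow> real" where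
  "C1_rd_norm T y =
     (SUP t\<in>kappa T. norm (y t)) + (SUP t\<in>kappa T. norm (delta_deriv T y t))"

definition class_C2 :: "('a::real_normed_vector \<Rightarrow> real) \<Rightarrow> bool" where
  "class_C2 f \<longleftrightarrow>
     (\<exists>(f' :: 'a \<Rightarrow> 'a \<Rightarrow>\<^sub>L real) (f'' :: 'a \<Rightarrow> 'a \<Rightarrow>\<^sub>L ('a \<Rightarrow>\<^sub>L real)).
        (\<forall>x. (f has_derivative blinfun_apply (f' x)) (at x)) \<and>
        (\<forall>x. (f' has_derivative blinfun_apply (f'' x)) (at x)) \<and>
        continuous_on UNIV f'')"

definition gradient :: "('a::real_inner \<Rightarrow> real) \<Rightarrow> 'a \<Rightarrow> 'a" where
  "gradient f x = (THE D. GDERIV f x :> D)"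

type_synonym 'n lagrangian = "real \<Rightarrow> real ^ 'n \<Rightarrow> real ^ 'n \<Rightarrow> real"

definition grad_w :: "'n::finite lagrangian \<Rightarrow> real \<Rightarrow> real ^ 'n \<Rightarrow> real ^ 'n \<Rightarrow> real ^ 'n" where
  "grad_w L t w v = gradient (\<lambda>w. L t w v) w"

definition grad_v :: "'n::finite lagrangian \<Rightarrow> real \<Rightarrow> real ^ 'n \<Rightarrow> real ^ 'n \<Rightarrow> real ^ 'n" where
  "grad_v L t w v = gradient (\<lambda>v. L t w v) v"

definition along ::
  "real set \<Rightarrow> (real \<Rightarrow> real ^ 'n \<Rightarrow> real ^ 'n \<Rightarrow> 'b) \<Rightarrow> (real \<Rightarrow> real ^ 'n) \<Rightarrow> real \<Rightarrow> 'b" where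
  "along T g y t = g t (y (fwd_jump T t)) (delta_deriv T y t)"

(* An endpoint value None means that the corresponding endpoint is free. *)
definition satisfies_bc ::
  "real \<Rightarrow> real \<Rightarrow> 'a option \<Rightarrow> 'a option \<Rightarrow> (real \<Rightarrow> 'a) \<Rightarrow> bool" where
  "satisfies_bc a b ya yb y \<longleftrightarrow>
     (\<forall>c. ya = Some c \<longrightarrow> y a = c) \<and> (\<forall>c. yb = Some c \<longrightarrow> y b = c)"

(* The inequality between the functional values presupposes that they are defined; since
   delta_integral is total, existence of the integrals has to be stated. *)
definition weak_local_minimizer ::
  "real set \<Rightarrow> real \<Rightarrow> real \<Rightarrow> 'n::finite lagrangian \<Rightarrow> (real ^ 'n) option \<Rightarrow> (real ^ 'n) option
     \<Rightarrow> (real \<Rightarrow> real ^ 'n) \<Rightarrow> bool" where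
  "weak_local_minimizer T a b L ya yb ystar \<longleftrightarrow>
     ystar \<in> C1_rd T \<and> satisfies_bc a b ya yb ystar \<and>
     (\<exists>\<delta>>0. \<forall>y\<in>C1_rd T. satisfies_bc a b ya yb y \<and> C1_rd_norm T (\<lambda>t. y t - ystar t) < \<delta> \<longrightarrow>
        (\<exists>I. has_delta_integral T (along T L y) a b I) \<and>
        delta_integral T (along T L ystar) a b \<le> delta_integral T (along T L y) a b)"

end

theory Submission
  imports Defs
begin

text \<open>Write \<open>p\<close> and \<open>q\<close> for the gradients of the Lagrangian in the second and third argument, evaluated
  along the minimizer. The proof is that of du Bois-Reymond: everything except one inequality is an
  exact computation with antiderivatives.

  For an admissible variation \<open>\<eta>\<close>, minimality gives that the integral of
  \<open>p \<bullet> \<eta>\<^sup>\<sigma> + q \<bullet> \<eta>\<^sup>\<Delta>\<close> vanishes (\<open>first_variation\<close>). This step cannot differentiate under the integral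
  sign, because the value of the functional is only known to exist as an increment of some
  antiderivative. Instead the increment of the integrand is bounded above by its linearization
  plus an error that is small uniformly in time, and increments of antiderivatives are compared by
  \<open>delta_increment_le\<close>. The uniformity rests on compactness and on the joint rd-continuity of the
  gradients (\<open>along_uniformly_continuous\<close>).

  Since \<open>p\<close> is rd-continuous, it has an antiderivative \<open>P\<close> (\<open>rd_continuous_antiderivative\<close>), and
  the product rule turns \<open>p \<bullet> \<eta>\<^sup>\<sigma>\<close> into the derivative of \<open>P \<bullet> \<eta>\<close> minus \<open>P \<bullet> \<eta>\<^sup>\<Delta>\<close>. Choosing
  \<open>\<eta>\<^sup>\<Delta> = q - P - c\<close>, with the constant \<open>c\<close> fixed by the requirement that \<open>\<eta>\<close> vanish at both ends,
  makes the first variation equal to the integral of the square of \<open>q - P - c\<close>. A nonnegative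
  function with zero integral that has an antiderivative vanishes at every point where derivatives are
  unique, so \<open>q = P + c\<close> on \<open>kappa T\<close> (\<open>du_bois_reymond\<close>). Hence \<open>q\<close> inherits the derivative \<open>p\<close>, which
  is the Euler-Lagrange equation. After \<open>c\<close> is absorbed into \<open>P\<close>, the first variation of any
  variation is the increment of \<open>P \<bullet> \<eta>\<close> from \<open>a\<close> to \<open>b\<close>, and affine \<open>\<eta>\<close> that vanish at one end only
  force \<open>P\<close> to vanish at each free end (\<open>natural_boundary_values\<close>). At \<open>b\<close> this is a statement about
  \<open>P b\<close>, which the jump formula expresses through \<open>\<rho>(b)\<close>.\<close>

section \<open>Jumps and the points where derivatives are unique\<close>

locale compact_time_scale =
  fixes T :: "real set" and a b :: real
  assumes closed_T: "closed T"
    and a_in: "a \<in> T" and b_in: "b \<in> T" and T_sub: "T \<subseteq> {a..b}" and a_less_b: "a < b"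
begin

abbreviation \<sigma> where "\<sigma> \<equiv> fwd_jump T"
abbreviation K where "K \<equiv> kappa T"

lemma bdd_below_gt: "bdd_below {s\<in>T. t < s}"
  by (rule bdd_belowI[of _ t]) auto

lemma bdd_above_lt: "bdd_above {s\<in>T. s < t}"
  by (rule bdd_aboveI[of _ t]) auto

lemma fwd_jump_ge: "t \<le> \<sigma> t"
  unfolding fwd_jump_def by (cases "\<exists>s\<in>T. t < s") (auto 4 0 intro!: cInf_greatest)

lemma fwd_jump_le: "s \<in> T \<Longrightarrow> t < s \<Longrightarrow> \<sigma> t \<le> s"
  unfolding fwd_jump_def by (auto intro!: cInf_lower bdd_below_gt)

lemma fwd_jump_in: "t \<in> T \<Longrightarrow> \<sigma> t \<in> T"
  unfolding fwd_jump_def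
  by (auto intro!: closed_subset_contains_Inf[OF closed_T] bdd_below_gt)

lemma fwd_jump_b [simp]: "\<sigma> b = b"
  using T_sub by (force simp: fwd_jump_def)

text \<open>Monotonicity on the whole line, not just on \<open>T\<close>, is what later makes the set of right-scattered
  points countable.\<close>

lemma mono_fwd_jump: "mono \<sigma>"
proof
  fix x y :: real assume "x \<le> y"
  show "\<sigma> x \<le> \<sigma> y"
  proof (cases "\<exists>s\<in>T. y < s")
    case True
    then have "\<sigma> y = Inf {s\<in>T. y < s}" by (simp add: fwd_jump_def)
    also have "\<dots> \<ge> \<sigma> x"
      using True \<open>x \<le> y\<close> by (intro cInf_greatest) (auto intro: fwd_jump_le)
    finally show ?thesis .
  next
    case False
    then have y: "\<sigma> y = y" by (simp add: fwd_jump_def)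
    show ?thesis
    proof (cases "\<exists>s\<in>T. x < s")
      case True
      then obtain s where "s \<in> T" "x < s" by blast
      with False show ?thesis using fwd_jump_le[of s x] y by fastforce
    qed (use y \<open>x \<le> y\<close> in \<open>auto simp: fwd_jump_def\<close>)
  qed
qed

lemma right_dense_approach:
  assumes "right_dense T t" "t \<in> T" "t < b" "0 < d"
  obtains s where "s \<in> T" "t < s" "s < t + d"
proof -
  have ne: "{s\<in>T. t < s} \<noteq> {}" using b_in assms by auto
  then have "Inf {s\<in>T. t < s} < t + d"
    using assms by (auto simp: right_dense_def fwd_jump_def split: if_splits)
  from cInf_lessD[OF ne this] that show ?thesis by auto
qed

lemma left_dense_approach:
  assumes "left_dense T t" "t \<in> T" "a < t" "0 < d"
  obtains s where "s \<in> T" "s < t" "t - d < s"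
proof -
  have ne: "{s\<in>T. s < t} \<noteq> {}" using a_in assms by auto
  then have "t - d < Sup {s\<in>T. s < t}"
    using assms by (auto simp: left_dense_def bwd_jump_def split: if_splits)
  from less_cSupD[OF ne this] that show ?thesis by auto
qed

lemma bwd_jump_le: "bwd_jump T t \<le> t"
  unfolding bwd_jump_def by (cases "\<exists>s\<in>T. s < t") (auto 4 0 intro!: cSup_least)

lemma bwd_jump_ge: "s \<in> T \<Longrightarrow> s < t \<Longrightarrow> s \<le> bwd_jump T t"
  unfolding bwd_jump_def by (auto intro!: cSup_upper bdd_above_lt)

lemma bwd_jump_in: "t \<in> T \<Longrightarrow> bwd_jump T t \<in> T"
  unfolding bwd_jump_def
  by (auto intro!: closed_subset_contains_Sup[OF closed_T] bdd_above_lt)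

lemma Sup_T: "Sup T = b"
  using T_sub b_in by (intro cSup_eq_maximum) auto

lemma kappa_eq: "K = T \<inter> {..bwd_jump T b}"
  using T_sub by (auto simp: kappa_def Sup_T)

lemma kappa_subset: "t \<in> K \<Longrightarrow> t \<in> T"
  by (simp add: kappa_eq)

text \<open>The truncation removes at most one point, the maximum, and only if that point is isolated from
  the left.\<close>

lemma in_kappa_iff: "t \<in> K \<longleftrightarrow> t \<in> T \<and> (t < b \<or> left_dense T b \<and> t = b)"
proof -
  have "t \<le> bwd_jump T b \<longleftrightarrow> t < b \<or> left_dense T b \<and> t = b" if "t \<in> T"
    using that T_sub bwd_jump_le[of b] bwd_jump_ge[of t b] by (force simp: left_dense_def)
  then show ?thesis by (auto simp: kappa_eq)
qed

lemma in_kappaI: "t \<in> T \<Longrightarrow> t < b \<Longrightarrow> t \<in> K"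
  by (simp add: in_kappa_iff)

lemma a_in_kappa: "a \<in> K"
  using a_in a_less_b by (simp add: in_kappa_iff)

lemma compact_kappa: "compact K"
proof -
  have "compact ({a..b} \<inter> (T \<inter> {..bwd_jump T b}))"
    by (intro compact_Int_closed closed_Int closed_T) auto
  then show ?thesis using T_sub by (simp add: kappa_eq Int_absorb1 flip: Int_assoc)
qed

lemma bwd_jump_b_in_kappa: "bwd_jump T b \<in> K"
  using bwd_jump_in[OF b_in] by (simp add: kappa_eq)

text \<open>Holds for both kinds of maximum: if \<open>b\<close> is left-dense, then \<open>\<rho>(b) = b\<close> and the convention at the
  maximum gives the value; otherwise \<open>b\<close> is the successor of \<open>\<rho>(b)\<close>.\<close>

lemma fwd_jump_bwd_jump_b: "\<sigma> (bwd_jump T b) = b"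
proof (cases "left_dense T b")
  case False
  then have "bwd_jump T b < b" using bwd_jump_le[of b] by (simp add: left_dense_def)
  moreover have "s = b" if "s \<in> T" "bwd_jump T b < s" for s
    using that T_sub bwd_jump_ge[of s b] by force
  ultimately have "{s\<in>T. bwd_jump T b < s} = {b}" using b_in by auto
  then show ?thesis using b_in \<open>bwd_jump T b < b\<close> by (auto simp: fwd_jump_def)
qed (simp add: left_dense_def)

text \<open>The difference quotient at \<open>t\<close> uses the points of \<open>T\<close> other than \<open>\<sigma> t\<close>. That such points exist
  arbitrarily close to \<open>t\<close> is what makes the derivative unique, and it is the reason for excluding an
  isolated maximum.\<close>

lemma kappa_approach:
  assumes "t \<in> K" "0 < d"
  obtains s where "s \<in> T" "\<bar>s - t\<bar> < d" "s \<noteq> \<sigma> t"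
proof (cases "right_dense T t")
  case False
  with that[of t] assms show ?thesis by (auto simp: right_dense_def kappa_subset)
next
  case True
  show ?thesis
  proof (cases "t < b")
    case True
    with \<open>right_dense T t\<close> assms obtain s where "s \<in> T" "t < s" "s < t + d"
      using right_dense_approach kappa_subset by blast
    with \<open>right_dense T t\<close> show ?thesis by (intro that) (auto simp: right_dense_def)
  next
    case False
    with assms have "left_dense T b" "t = b" by (auto simp: in_kappa_iff)
    moreover obtain s where "s \<in> T" "s < b" "b - d < s"
      using left_dense_approach[OF \<open>left_dense T b\<close> b_in a_less_b assms(2)] .
    ultimately show ?thesis by (intro that[of s]) auto
  qed
qed

section \<open>Calculus of the delta derivative\<close>

lemma has_delta_derivD:
  assumes "has_delta_deriv T f D t" "0 < e"
  obtains d where "0 < d" "\<And>s. s \<in> T \<Longrightarrow> \<bar>s - t\<bar> < d \<Longrightarrow>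
     norm (f (\<sigma> t) - f s - (\<sigma> t - s) *\<^sub>R D) \<le> e * \<bar>\<sigma> t - s\<bar>"
proof -
  from assms obtain d where "0 < d" "\<forall>s \<in> {t - d<..<t + d} \<inter> T.
     norm (f (\<sigma> t) - f s - (\<sigma> t - s) *\<^sub>R D) \<le> e * \<bar>\<sigma> t - s\<bar>"
    unfolding has_delta_deriv_def by blast
  then show ?thesis by (intro that[of d]) (auto simp: abs_less_iff)
qed

lemma has_delta_derivI:
  assumes "\<And>e. 0 < e \<Longrightarrow> \<exists>d>0. \<forall>s\<in>T. \<bar>s - t\<bar> < d \<longrightarrow>
     norm (f (\<sigma> t) - f s - (\<sigma> t - s) *\<^sub>R D) \<le> e * \<bar>\<sigma> t - s\<bar>"
  shows "has_delta_deriv T f D t"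
  unfolding has_delta_deriv_def
proof (intro allI impI)
  fix e :: real assume "0 < e"
  from assms[OF this] obtain d where "0 < d" "\<forall>s\<in>T. \<bar>s - t\<bar> < d \<longrightarrow>
     norm (f (\<sigma> t) - f s - (\<sigma> t - s) *\<^sub>R D) \<le> e * \<bar>\<sigma> t - s\<bar>" by blast
  then show "\<exists>d>0. \<forall>s\<in>{t - d<..<t + d} \<inter> T.
     norm (f (\<sigma> t) - f s - (\<sigma> t - s) *\<^sub>R D) \<le> e * \<bar>\<sigma> t - s\<bar>"
    by (intro exI[of _ d]) (auto simp: abs_less_iff)
qed

lemma has_delta_deriv_unique:
  assumes "has_delta_deriv T f D t" "has_delta_deriv T f E t" "t \<in> K"
  shows "D = E"
proof -
  have "norm (D - E) \<le> 0 + e" if "0 < e" for e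
  proof -
    have e: "0 < e / 2" using that by simp
    obtain d1 where d1: "0 < d1" "\<And>s. s \<in> T \<Longrightarrow> \<bar>s - t\<bar> < d1 \<Longrightarrow>
       norm (f (\<sigma> t) - f s - (\<sigma> t - s) *\<^sub>R D) \<le> e / 2 * \<bar>\<sigma> t - s\<bar>"
      using has_delta_derivD[OF assms(1) e] by blast
    obtain d2 where d2: "0 < d2" "\<And>s. s \<in> T \<Longrightarrow> \<bar>s - t\<bar> < d2 \<Longrightarrow>
       norm (f (\<sigma> t) - f s - (\<sigma> t - s) *\<^sub>R E) \<le> e / 2 * \<bar>\<sigma> t - s\<bar>"
      using has_delta_derivD[OF assms(2) e] by blast
    obtain s where s: "s \<in> T" "\<bar>s - t\<bar> < min d1 d2" "s \<noteq> \<sigma> t"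
      using kappa_approach[OF assms(3), of "min d1 d2"] d1 d2 by auto
    let ?R = "\<lambda>D. f (\<sigma> t) - f s - (\<sigma> t - s) *\<^sub>R D"
    have "\<bar>\<sigma> t - s\<bar> * norm (D - E) = norm (?R E - ?R D)"
    proof -
      have "?R E - ?R D = (\<sigma> t - s) *\<^sub>R (D - E)" by (simp add: scaleR_diff_right)
      then show ?thesis by simp
    qed
    also have "\<dots> \<le> norm (?R E) + norm (?R D)" by (rule norm_triangle_ineq4)
    also have "\<dots> \<le> e / 2 * \<bar>\<sigma> t - s\<bar> + e / 2 * \<bar>\<sigma> t - s\<bar>"
      using d1(2)[of s] d2(2)[of s] s by (intro add_mono) auto
    finally show ?thesis using s(3) by (simp add: field_simps)
  qed
  then have "norm (D - E) \<le> 0" by (rule field_le_epsilon)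
  then show ?thesis by simp
qed

lemma delta_deriv_eq: "has_delta_deriv T f D t \<Longrightarrow> t \<in> K \<Longrightarrow> delta_deriv T f t = D"
  unfolding delta_deriv_def using has_delta_deriv_unique by blast

text \<open>The point \<open>s = t\<close> is allowed in the definition of the derivative. There the left-hand side does
  not depend on \<open>\<epsilon>\<close>, so the estimate becomes an identity.\<close>

lemma delta_deriv_fwd_jump:
  assumes "has_delta_deriv T f D t" "t \<in> K"
  shows "f (\<sigma> t) = f t + (\<sigma> t - t) *\<^sub>R D"
proof -
  have "norm (f (\<sigma> t) - f t - (\<sigma> t - t) *\<^sub>R D) \<le> 0 + e" if "0 < e" for e
  proof -
    have "0 < e / (\<bar>\<sigma> t - t\<bar> + 1)" using that by (simp add: add_nonneg_pos)
    then obtain d where "0 < d" "\<And>s. s \<in> T \<Longrightarrow> \<bar>s - t\<bar> < d \<Longrightarrow>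
       norm (f (\<sigma> t) - f s - (\<sigma> t - s) *\<^sub>R D) \<le> e / (\<bar>\<sigma> t - t\<bar> + 1) * \<bar>\<sigma> t - s\<bar>"
      using has_delta_derivD[OF assms(1)] by blast
    from this(1) this(2)[of t] kappa_subset[OF assms(2)]
    have "norm (f (\<sigma> t) - f t - (\<sigma> t - t) *\<^sub>R D) \<le> e / (\<bar>\<sigma> t - t\<bar> + 1) * \<bar>\<sigma> t - t\<bar>"
      by simp
    also have "\<dots> \<le> e" using that by (simp add: field_simps)
    finally show ?thesis by simp
  qed
  then have "norm (f (\<sigma> t) - f t - (\<sigma> t - t) *\<^sub>R D) \<le> 0" by (rule field_le_epsilon)
  then show ?thesis by (simp add: diff_eq_eq add.commute)
qed

lemma delta_deriv_continuous:
  assumes "has_delta_deriv T f D t" "t \<in> K"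
  shows "continuous (at t within T) f"
proof -
  have "\<exists>d>0. \<forall>s\<in>T. dist s t < d \<longrightarrow> dist (f s) (f t) < e" if "0 < e" for e
  proof -
    define m where "m = \<bar>\<sigma> t - t\<bar> + 1"
    have m: "0 < m" by (simp add: m_def add_nonneg_pos)
    then have "0 < e / (2 * m)" using that by simp
    then obtain d where d: "0 < d" "\<And>s. s \<in> T \<Longrightarrow> \<bar>s - t\<bar> < d \<Longrightarrow>
       norm (f (\<sigma> t) - f s - (\<sigma> t - s) *\<^sub>R D) \<le> e / (2 * m) * \<bar>\<sigma> t - s\<bar>"
      using has_delta_derivD[OF assms(1)] by blast
    define d' where "d' = min d (min 1 (e / (2 * (norm D + 1))))"
    have nD: "0 < norm D + 1" by (simp add: add_nonneg_pos)
    have "dist (f s) (f t) < e" if s: "s \<in> T" "\<bar>s - t\<bar> < d'" for s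
    proof -
      have "f s - f t = (s - t) *\<^sub>R D - (f (\<sigma> t) - f s - (\<sigma> t - s) *\<^sub>R D)"
        by (simp add: delta_deriv_fwd_jump[OF assms] algebra_simps)
      then have "norm (f s - f t) \<le> \<bar>s - t\<bar> * norm D + norm (f (\<sigma> t) - f s - (\<sigma> t - s) *\<^sub>R D)"
        by (metis norm_scaleR norm_triangle_ineq4)
      also have "norm (f (\<sigma> t) - f s - (\<sigma> t - s) *\<^sub>R D) \<le> e / (2 * m) * \<bar>\<sigma> t - s\<bar>"
        using d(2)[of s] s by (simp add: d'_def)
      also have "\<dots> \<le> e / (2 * m) * m"
        using s \<open>0 < e / (2 * m)\<close> by (intro mult_left_mono) (auto simp: m_def d'_def)
      also have "\<dots> = e / 2" using m by simp
      also have "\<bar>s - t\<bar> * norm D < e / 2"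
      proof -
        have "\<bar>s - t\<bar> * norm D \<le> \<bar>s - t\<bar> * (norm D + 1)" by (intro mult_left_mono) auto
        also have "\<dots> < e / (2 * (norm D + 1)) * (norm D + 1)"
          using s nD by (intro mult_strict_right_mono) (auto simp: d'_def)
        also have "\<dots> = e / 2" using nD by (simp add: divide_simps)
        finally show ?thesis .
      qed
      finally show ?thesis by (simp add: dist_norm)
    qed
    moreover have "0 < d'" using d(1) \<open>0 < e\<close> nD by (simp add: d'_def)
    ultimately show ?thesis by (intro exI[of _ d']) (auto simp: dist_real_def)
  qed
  then show ?thesis unfolding continuous_within_eps_delta by blast
qed

lemma has_delta_deriv_const: "has_delta_deriv T (\<lambda>_. c) 0 t"
  by (rule has_delta_derivI) (auto intro!: exI[of _ 1])

lemma has_delta_deriv_affine: "has_delta_deriv T (\<lambda>t. (t - c) *\<^sub>R v) v t"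
  by (rule has_delta_derivI) (auto intro!: exI[of _ 1] simp flip: scaleR_diff_left)

lemma has_delta_deriv_add:
  assumes "has_delta_deriv T f D t" "has_delta_deriv T g E t"
  shows "has_delta_deriv T (\<lambda>s. f s + g s) (D + E) t"
proof (rule has_delta_derivI)
  fix e :: real assume "0 < e"
  then have e: "0 < e / 2" by simp
  obtain d1 where d1: "0 < d1" "\<And>s. s \<in> T \<Longrightarrow> \<bar>s - t\<bar> < d1 \<Longrightarrow>
     norm (f (\<sigma> t) - f s - (\<sigma> t - s) *\<^sub>R D) \<le> e / 2 * \<bar>\<sigma> t - s\<bar>"
    using has_delta_derivD[OF assms(1) e] by blast
  obtain d2 where d2: "0 < d2" "\<And>s. s \<in> T \<Longrightarrow> \<bar>s - t\<bar> < d2 \<Longrightarrow>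
     norm (g (\<sigma> t) - g s - (\<sigma> t - s) *\<^sub>R E) \<le> e / 2 * \<bar>\<sigma> t - s\<bar>"
    using has_delta_derivD[OF assms(2) e] by blast
  have "norm (f (\<sigma> t) + g (\<sigma> t) - (f s + g s) - (\<sigma> t - s) *\<^sub>R (D + E)) \<le> e * \<bar>\<sigma> t - s\<bar>"
    if "s \<in> T" "\<bar>s - t\<bar> < min d1 d2" for s
  proof -
    have "f (\<sigma> t) + g (\<sigma> t) - (f s + g s) - (\<sigma> t - s) *\<^sub>R (D + E)
      = (f (\<sigma> t) - f s - (\<sigma> t - s) *\<^sub>R D) + (g (\<sigma> t) - g s - (\<sigma> t - s) *\<^sub>R E)"
      by (simp add: algebra_simps)
    also have "norm \<dots> \<le> e / 2 * \<bar>\<sigma> t - s\<bar> + e / 2 * \<bar>\<sigma> t - s\<bar>"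
      using d1(2)[of s] d2(2)[of s] that by (intro norm_triangle_le add_mono) auto
    finally show ?thesis by (simp add: field_simps)
  qed
  then show "\<exists>d>0. \<forall>s\<in>T. \<bar>s - t\<bar> < d \<longrightarrow>
     norm (f (\<sigma> t) + g (\<sigma> t) - (f s + g s) - (\<sigma> t - s) *\<^sub>R (D + E)) \<le> e * \<bar>\<sigma> t - s\<bar>"
    using d1(1) d2(1) by (intro exI[of _ "min d1 d2"]) auto
qed

lemma has_delta_deriv_scaleR:
  assumes "has_delta_deriv T f D t"
  shows "has_delta_deriv T (\<lambda>s. c *\<^sub>R f s) (c *\<^sub>R D) t"
proof (rule has_delta_derivI)
  fix e :: real assume "0 < e"
  then have "0 < e / (\<bar>c\<bar> + 1)" by (simp add: add_nonneg_pos)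
  then obtain d where d: "0 < d" "\<And>s. s \<in> T \<Longrightarrow> \<bar>s - t\<bar> < d \<Longrightarrow>
     norm (f (\<sigma> t) - f s - (\<sigma> t - s) *\<^sub>R D) \<le> e / (\<bar>c\<bar> + 1) * \<bar>\<sigma> t - s\<bar>"
    using has_delta_derivD[OF assms(1)] by blast
  have "norm (c *\<^sub>R f (\<sigma> t) - c *\<^sub>R f s - (\<sigma> t - s) *\<^sub>R (c *\<^sub>R D)) \<le> e * \<bar>\<sigma> t - s\<bar>"
    if "s \<in> T" "\<bar>s - t\<bar> < d" for s
  proof -
    have "c *\<^sub>R f (\<sigma> t) - c *\<^sub>R f s - (\<sigma> t - s) *\<^sub>R (c *\<^sub>R D)
      = c *\<^sub>R (f (\<sigma> t) - f s - (\<sigma> t - s) *\<^sub>R D)"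
      by (simp add: scaleR_diff_right)
    also have "norm \<dots> \<le> \<bar>c\<bar> * (e / (\<bar>c\<bar> + 1) * \<bar>\<sigma> t - s\<bar>)"
      unfolding norm_scaleR by (intro mult_left_mono d(2)[OF that]) auto
    also have "\<dots> = \<bar>c\<bar> * (e / (\<bar>c\<bar> + 1)) * \<bar>\<sigma> t - s\<bar>" by simp
    also have "\<dots> \<le> e * \<bar>\<sigma> t - s\<bar>"
      using \<open>0 < e\<close> by (intro mult_right_mono) (auto simp: field_simps)
    finally show ?thesis .
  qed
  with d(1) show "\<exists>d>0. \<forall>s\<in>T. \<bar>s - t\<bar> < d \<longrightarrow>
     norm (c *\<^sub>R f (\<sigma> t) - c *\<^sub>R f s - (\<sigma> t - s) *\<^sub>R (c *\<^sub>R D)) \<le> e * \<bar>\<sigma> t - s\<bar>"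
    by blast
qed

lemma has_delta_deriv_diff:
  assumes "has_delta_deriv T f D t" "has_delta_deriv T g E t"
  shows "has_delta_deriv T (\<lambda>s. f s - g s) (D - E) t"
  using has_delta_deriv_add[OF assms(1) has_delta_deriv_scaleR[OF assms(2), of "-1"]] by simp

text \<open>The product rule is asymmetric: one factor is evaluated at \<open>\<sigma> t\<close> and the other at \<open>t\<close>. The
  decomposition of the remainder pairs the remainder of \<open>f\<close> with the fixed vector \<open>g (\<sigma> t)\<close> and that of
  \<open>g\<close> with \<open>f s\<close>; the discrepancy \<open>f s - f t\<close> is small by continuity.\<close>

lemma has_delta_deriv_inner:
  fixes f g :: "real \<Rightarrow> 'v::real_inner"
  assumes f: "has_delta_deriv T f D t" and g: "has_delta_deriv T g E t" and t: "t \<in> K"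
  shows "has_delta_deriv T (\<lambda>s. f s \<bullet> g s) (D \<bullet> g (\<sigma> t) + f t \<bullet> E) t"
proof (rule has_delta_derivI)
  fix e :: real assume "0 < e"
  define M where "M = norm (g (\<sigma> t)) + (norm (f t) + 1) + norm E"
  have M: "0 < M" by (simp add: M_def add_pos_nonneg add_nonneg_pos)
  \<comment> \<open>The bound by 1 keeps \<open>norm (f s)\<close> below \<open>norm (f t) + 1\<close>.\<close>
  define e' where "e' = min 1 (e / M)"
  have e': "0 < e'" using \<open>0 < e\<close> M by (simp add: e'_def)
  obtain d1 where d1: "0 < d1" "\<And>s. s \<in> T \<Longrightarrow> \<bar>s - t\<bar> < d1 \<Longrightarrow>
     norm (f (\<sigma> t) - f s - (\<sigma> t - s) *\<^sub>R D) \<le> e' * \<bar>\<sigma> t - s\<bar>"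
    using has_delta_derivD[OF f e'] by blast
  obtain d2 where d2: "0 < d2" "\<And>s. s \<in> T \<Longrightarrow> \<bar>s - t\<bar> < d2 \<Longrightarrow>
     norm (g (\<sigma> t) - g s - (\<sigma> t - s) *\<^sub>R E) \<le> e' * \<bar>\<sigma> t - s\<bar>"
    using has_delta_derivD[OF g e'] by blast
  obtain d3 where d3: "0 < d3" "\<And>s. s \<in> T \<Longrightarrow> \<bar>s - t\<bar> < d3 \<Longrightarrow> norm (f s - f t) < e'"
    using delta_deriv_continuous[OF f t] e'
    unfolding continuous_within_eps_delta dist_norm real_norm_def by blast
  have "norm (f (\<sigma> t) \<bullet> g (\<sigma> t) - f s \<bullet> g s - (\<sigma> t - s) *\<^sub>R (D \<bullet> g (\<sigma> t) + f t \<bullet> E))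
      \<le> e * \<bar>\<sigma> t - s\<bar>"
    if s: "s \<in> T" "\<bar>s - t\<bar> < min d1 (min d2 d3)" for s
  proof -
    let ?F = "f (\<sigma> t) - f s - (\<sigma> t - s) *\<^sub>R D" and ?G = "g (\<sigma> t) - g s - (\<sigma> t - s) *\<^sub>R E"
    have fs: "norm (f s - f t) \<le> e'" using d3(2) s by (auto intro: less_imp_le)
    have "norm (f s) \<le> norm (f t) + norm (f s - f t)" by (metis norm_triangle_sub)
    with fs have nf: "norm (f s) \<le> norm (f t) + 1" by (simp add: e'_def)
    have "f (\<sigma> t) \<bullet> g (\<sigma> t) - f s \<bullet> g s - (\<sigma> t - s) *\<^sub>R (D \<bullet> g (\<sigma> t) + f t \<bullet> E)
      = ?F \<bullet> g (\<sigma> t) + f s \<bullet> ?G + (\<sigma> t - s) * ((f s - f t) \<bullet> E)"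
      by (simp add: algebra_simps inner_diff_left inner_diff_right)
    also have "norm \<dots> \<le> norm (?F \<bullet> g (\<sigma> t)) + norm (f s \<bullet> ?G) + norm ((\<sigma> t - s) * ((f s - f t) \<bullet> E))"
      by (intro norm_triangle_mono order_refl)
    also have "\<dots> \<le> norm ?F * norm (g (\<sigma> t)) + norm (f s) * norm ?G
        + \<bar>\<sigma> t - s\<bar> * (norm (f s - f t) * norm E)"
      unfolding norm_mult real_norm_def abs_mult
      by (intro add_mono mult_left_mono Cauchy_Schwarz_ineq2) auto
    also have "\<dots> \<le> (e' * \<bar>\<sigma> t - s\<bar>) * norm (g (\<sigma> t)) + (norm (f t) + 1) * (e' * \<bar>\<sigma> t - s\<bar>)
        + \<bar>\<sigma> t - s\<bar> * (e' * norm E)"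
      using d1(2) d2(2) s nf fs by (intro add_mono mult_mono mult_left_mono mult_right_mono) auto
    also have "\<dots> = e' * M * \<bar>\<sigma> t - s\<bar>" by (simp add: M_def algebra_simps)
    also have "\<dots> \<le> e * \<bar>\<sigma> t - s\<bar>"
      using M by (intro mult_right_mono) (auto simp: e'_def min_def field_simps)
    finally show ?thesis .
  qed
  with d1(1) d2(1) d3(1) show "\<exists>d>0. \<forall>s\<in>T. \<bar>s - t\<bar> < d \<longrightarrow>
      norm (f (\<sigma> t) \<bullet> g (\<sigma> t) - f s \<bullet> g s - (\<sigma> t - s) *\<^sub>R (D \<bullet> g (\<sigma> t) + f t \<bullet> E))
      \<le> e * \<bar>\<sigma> t - s\<bar>"
    by (intro exI[of _ "min d1 (min d2 d3)"]) auto
qed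

section \<open>Monotonicity\<close>

text \<open>Induction along the time scale. After adding a small slope \<open>c\<close> to \<open>F\<close>, let \<open>t\<close> be the supremum of
  the points up to which the inequality holds. The inequality holds at \<open>t\<close> itself, by continuity if
  \<open>t\<close> is left-dense and because the supremum is attained otherwise. It then continues past \<open>t\<close>: over a
  gap by the jump formula, and at a right-dense point because the slope \<open>c\<close> absorbs the error
  in the derivative. So \<open>t\<close> must be the maximum.\<close>

lemma nonneg_deriv_imp_mono:
  assumes F: "\<And>t. t \<in> K \<Longrightarrow> has_delta_deriv T F (f t) t" and f: "\<And>t. t \<in> K \<Longrightarrow> 0 \<le> f t"
    and x: "x \<in> T" and y: "y \<in> T" "x \<le> y"
  shows "F x \<le> (F y :: real)"
proof -
  have "F x \<le> F y + e" if "0 < e" for e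
  proof -
    define c where "c = e / (b - a)"
    have c: "0 < c" using that a_less_b by (simp add: c_def)
    define G where "G = (\<lambda>t. F t - F x + c * (t - x))"
    define A where "A = {t\<in>T. x \<le> t \<and> (\<forall>s\<in>T. x \<le> s \<longrightarrow> s \<le> t \<longrightarrow> 0 \<le> G s)}"
    have "x \<in> A" using x by (auto simp: A_def G_def)
    have bdd: "bdd_above A" using T_sub by (intro bdd_aboveI[of _ b]) (auto simp: A_def)
    define t where "t = Sup A"
    have "t \<in> T" unfolding t_def
      using \<open>x \<in> A\<close> bdd by (intro closed_subset_contains_Sup[OF closed_T]) (auto simp: A_def)
    have "x \<le> t" unfolding t_def using \<open>x \<in> A\<close> bdd by (rule cSup_upper)
    have below: "0 \<le> G s" if s: "s \<in> T" "x \<le> s" "s < t" for s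
    proof -
      from less_cSupD[of A s] that \<open>x \<in> A\<close> obtain u where "u \<in> A" "s < u"
        unfolding t_def by auto
      with that show ?thesis by (auto simp: A_def)
    qed
    have "0 \<le> G t"
    proof (cases "t \<in> A")
      case False
      then have "x < t" using \<open>x \<in> A\<close> \<open>x \<le> t\<close> by (auto simp: order_less_le)
      then have "a < t" using x T_sub by force
      show ?thesis
      proof (cases "left_dense T t")
        case True
        with \<open>t \<in> T\<close> T_sub have "t \<in> K" by (cases "t = b") (auto simp: in_kappa_iff)
        from delta_deriv_continuous[OF F[OF this] this]
        have "(F \<longlongrightarrow> F t) (at t within (T \<inter> {..<t}))"
          by (auto simp: continuous_within intro: tendsto_within_subset)
        then have lim: "(G \<longlongrightarrow> G t) (at t within (T \<inter> {..<t}))"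
          unfolding G_def by (intro tendsto_intros)
        have "at t within (T \<inter> {..<t}) \<noteq> bot"
          unfolding trivial_limit_within islimpt_approachable
        proof (intro notI, elim notE, intro allI impI)
          fix d :: real assume "0 < d"
          then obtain s where "s \<in> T" "s < t" "t - d < s"
            using left_dense_approach[OF True \<open>t \<in> T\<close> \<open>a < t\<close>] by blast
          then show "\<exists>s\<in>T \<inter> {..<t}. s \<noteq> t \<and> dist s t < d"
            by (intro bexI[of _ s]) (auto simp: dist_real_def)
        qed
        moreover have "\<forall>\<^sub>F s in at t within (T \<inter> {..<t}). 0 \<le> G s"
          unfolding eventually_at using \<open>x < t\<close>
          by (intro exI[of _ "t - x"]) (auto simp: dist_real_def intro: below)
        ultimately show ?thesis using tendsto_lowerbound[OF lim] by blast
      next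
        case False
        then have "bwd_jump T t < t" using bwd_jump_le[of t] by (simp add: left_dense_def)
        from less_cSupD[of A, OF _ this[unfolded t_def]] \<open>x \<in> A\<close>
        obtain u where u: "u \<in> A" "bwd_jump T t < u" unfolding t_def[symmetric] by blast
        then have "u \<le> t" using cSup_upper[OF u(1) bdd] by (simp add: t_def)
        with u bwd_jump_ge[of u t] have "u = t" by (force simp: A_def)
        with u show ?thesis by (auto simp: A_def)
      qed
    qed (auto simp: A_def)
    with below have "t \<in> A" using \<open>t \<in> T\<close> \<open>x \<le> t\<close> by (force simp: A_def order_le_less)
    have "t = b"
    proof (rule ccontr)
      assume "t \<noteq> b"
      with \<open>t \<in> T\<close> T_sub have "t < b" by force
      with \<open>t \<in> T\<close> have "t \<in> K" by (simp add: in_kappa_iff)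
      have "\<exists>u\<in>A. t < u"
      proof (cases "right_dense T t")
        case True
        obtain d where d: "0 < d" "\<And>s. s \<in> T \<Longrightarrow> \<bar>s - t\<bar> < d \<Longrightarrow>
            norm (F (\<sigma> t) - F s - (\<sigma> t - s) *\<^sub>R f t) \<le> c * \<bar>\<sigma> t - s\<bar>"
          using has_delta_derivD[OF F[OF \<open>t \<in> K\<close>] c] by blast
        have step: "0 \<le> G s" if s: "s \<in> T" "t < s" "s < t + d" for s
        proof -
          have "(s - t) * f t \<ge> 0" using f[OF \<open>t \<in> K\<close>] s by simp
          with d(2)[of s] s True have "F t - F s \<le> c * (s - t)"
            by (simp add: right_dense_def algebra_simps abs_le_iff)
          with \<open>0 \<le> G t\<close> show ?thesis by (simp add: G_def algebra_simps)
        qed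
        obtain s where s: "s \<in> T" "t < s" "s < t + d"
          using right_dense_approach[OF True \<open>t \<in> T\<close> \<open>t < b\<close> d(1)] .
        have "0 \<le> G u" if "u \<in> T" "x \<le> u" "u \<le> s" for u
          using that s step[of u] below[of u] \<open>0 \<le> G t\<close> by (cases u t rule: linorder_cases) auto
        with s \<open>x \<le> t\<close> show ?thesis by (intro bexI[of _ s]) (auto simp: A_def)
      next
        case False
        then have lt: "t < \<sigma> t" using fwd_jump_ge[of t] by (simp add: right_dense_def)
        have "0 \<le> (\<sigma> t - t) * f t" using f[OF \<open>t \<in> K\<close>] lt by simp
        moreover have "0 \<le> c * (\<sigma> t - t)" using c lt by simp
        ultimately have "0 \<le> G (\<sigma> t)"
          using delta_deriv_fwd_jump[OF F[OF \<open>t \<in> K\<close>] \<open>t \<in> K\<close>] \<open>0 \<le> G t\<close>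
          by (simp add: G_def algebra_simps)
        moreover have "u = \<sigma> t" if "u \<in> T" "t < u" "u \<le> \<sigma> t" for u
          using fwd_jump_le[of u t] that by simp
        ultimately have "0 \<le> G u" if "u \<in> T" "x \<le> u" "u \<le> \<sigma> t" for u
          using that below[of u] \<open>0 \<le> G t\<close> by (cases u t rule: linorder_cases) auto
        with lt \<open>x \<le> t\<close> fwd_jump_in[OF \<open>t \<in> T\<close>] show ?thesis by (intro bexI[of _ "\<sigma> t"]) (auto simp: A_def)
      qed
      then obtain u where "u \<in> A" "t < u" by blast
      with cSup_upper[OF _ bdd, of u] show False by (simp add: t_def)
    qed
    then have "0 \<le> G y" using \<open>t \<in> A\<close> y T_sub by (force simp: A_def)
    moreover have "c * (y - x) \<le> c * (b - a)"
      using c x y T_sub by (intro mult_left_mono diff_mono) auto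
    moreover have "c * (b - a) = e" using a_less_b by (simp add: c_def)
    ultimately show ?thesis by (simp add: G_def)
  qed
  then show ?thesis by (rule field_le_epsilon)
qed

lemma delta_increment_le:
  assumes F: "\<And>t. t \<in> K \<Longrightarrow> has_delta_deriv T F (f t) t"
    and G: "\<And>t. t \<in> K \<Longrightarrow> has_delta_deriv T G (g t) t"
    and le: "\<And>t. t \<in> K \<Longrightarrow> f t \<le> (g t :: real)"
  shows "F b - F a \<le> G b - G a"
  using nonneg_deriv_imp_mono[OF has_delta_deriv_diff[OF G F], of a b] le a_in b_in a_less_b by simp

lemma delta_integral_eq:
  assumes "has_delta_integral T f a b I"
  shows "delta_integral T f a b = I"
  unfolding delta_integral_def
proof (rule the_equality)
  fix J assume "has_delta_integral T f a b J"
  with assms show "J = I"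
    unfolding has_delta_integral_def using delta_increment_le[of _ f _ f] by (metis order_antisym order_refl)
qed (rule assms)

section \<open>Compactness and rd-continuity\<close>

text \<open>Rd-continuity controls a function near a point through two one-sided filters, which are trivial on
  the scattered side. If a property with a tolerance \<open>d\<close> holds along both filters and at the point,
  it holds in a full neighbourhood, and compactness of \<open>kappa T\<close> yields one tolerance for all points.
  Both the boundedness of rd-continuous functions and the uniform continuity of the gradients along a
  trajectory are instances.\<close>

lemma rd_local_imp_uniform:
  fixes P :: "real \<Rightarrow> real \<Rightarrow> bool"
  assumes anti: "\<And>c d t. P d t \<Longrightarrow> 0 < c \<Longrightarrow> c \<le> d \<Longrightarrow> P c t"
    and pt: "\<And>t. t \<in> K \<Longrightarrow> \<exists>d>0. P d t"
    and right: "\<And>t. t \<in> K \<Longrightarrow> right_dense T t \<Longrightarrow>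
      \<exists>d>0. \<forall>\<^sub>F s in at t within K. P d s"
    and left: "\<And>t. t \<in> K \<Longrightarrow> left_dense T t \<Longrightarrow>
      \<exists>d>0. \<forall>\<^sub>F s in at t within (K \<inter> {..<t}). P d s"
  shows "\<exists>d>0. \<forall>t\<in>K. P d t"
proof -
  have "\<exists>d>0. \<exists>r>0. \<forall>s\<in>K. dist s t < r \<longrightarrow> P d s" if t: "t \<in> K" for t
  proof -
    obtain d0 where d0: "0 < d0" "P d0 t" using pt[OF t] by blast
    have "\<exists>d>0. \<forall>\<^sub>F s in at t within (K \<inter> {..<t}). P d s"
    proof (cases "left_dense T t")
      case False
      then have lt: "bwd_jump T t < t" using bwd_jump_le[of t] by (simp add: left_dense_def)
      \<comment> \<open>The filter is trivial, so any tolerance serves.\<close>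
      have "\<forall>\<^sub>F s in at t within (K \<inter> {..<t}). P 1 s"
        unfolding eventually_at using bwd_jump_ge[OF kappa_subset, of _ t] lt
        by (intro exI[of _ "t - bwd_jump T t"]) (force simp: dist_real_def)
      then show ?thesis by (intro exI[of _ 1]) auto
    qed (rule left[OF t])
    then obtain d1 where d1: "0 < d1" "\<forall>\<^sub>F s in at t within (K \<inter> {..<t}). P d1 s" by blast
    have "\<exists>d>0. \<forall>\<^sub>F s in at t within (K \<inter> {t<..}). P d s"
    proof (cases "right_dense T t")
      case True
      from right[OF t this] obtain d where "0 < d" "\<forall>\<^sub>F s in at t within K. P d s" by blast
      moreover have "at t within (K \<inter> {t<..}) \<le> at t within K" by (rule at_le) auto
      ultimately show ?thesis by (auto intro: filter_leD)
    next
      case False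
      then have lt: "t < \<sigma> t" using fwd_jump_ge[of t] by (simp add: right_dense_def)
      have "\<forall>\<^sub>F s in at t within (K \<inter> {t<..}). P 1 s"
        unfolding eventually_at using fwd_jump_le[OF kappa_subset, of _ t] lt
        by (intro exI[of _ "\<sigma> t - t"]) (force simp: dist_real_def)
      then show ?thesis by (intro exI[of _ 1]) auto
    qed
    then obtain d2 where d2: "0 < d2" "\<forall>\<^sub>F s in at t within (K \<inter> {t<..}). P d2 s" by blast
    define d where "d = min d0 (min d1 d2)"
    have d: "0 < d" "d \<le> d0" "d \<le> d1" "d \<le> d2" using d0 d1 d2 by (auto simp: d_def)
    obtain r1 where r1: "0 < r1" "\<And>s. s \<in> K \<Longrightarrow> s < t \<Longrightarrow> dist s t < r1 \<Longrightarrow> P d1 s"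
      using d1(2) unfolding eventually_at by auto
    obtain r2 where r2: "0 < r2" "\<And>s. s \<in> K \<Longrightarrow> t < s \<Longrightarrow> dist s t < r2 \<Longrightarrow> P d2 s"
      using d2(2) unfolding eventually_at by auto
    have "P d s" if "s \<in> K" "dist s t < min r1 r2" for s
    proof (cases s t rule: linorder_cases)
      case less
      then show ?thesis using r1(2)[of s] that anti[OF _ d(1,3)] by simp
    next
      case equal
      then show ?thesis using d0(2) anti[OF _ d(1,2)] by simp
    next
      case greater
      then show ?thesis using r2(2)[of s] that anti[OF _ d(1,4)] by simp
    qed
    with d(1) r1(1) r2(1) show ?thesis by (intro exI[of _ d] conjI exI[of _ "min r1 r2"]) auto
  qed
  then obtain d r where dr: "\<And>t. t \<in> K \<Longrightarrow> 0 < d t \<and> 0 < r t"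
      "\<And>t s. t \<in> K \<Longrightarrow> s \<in> K \<Longrightarrow> dist s t < r t \<Longrightarrow> P (d t) s"
    by metis
  have "K \<subseteq> (\<Union>t\<in>K. ball t (r t))" using dr(1) by force
  with compactE_image[OF compact_kappa, of K "\<lambda>t. ball t (r t)"]
  obtain C where C: "C \<subseteq> K" "finite C" "K \<subseteq> (\<Union>t\<in>C. ball t (r t))" by auto
  define m where "m = Min (d ` C)"
  have "C \<noteq> {}" using C(3) a_in_kappa by auto
  then have m: "0 < m" "\<And>t. t \<in> C \<Longrightarrow> m \<le> d t"
    using C dr(1) by (auto simp: m_def)
  have "P m s" if s: "s \<in> K" for s
  proof -
    from C(3) s obtain t where "t \<in> C" "dist t s < r t" by auto
    then show ?thesis
      using dr(2)[of t s] C(1) s anti[OF _ m(1) m(2)] by (auto simp: dist_commute)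
  qed
  with m(1) show ?thesis by blast
qed

text \<open>The tolerance \<open>d\<close> encodes the bound \<open>1 / d\<close>, so that a smaller tolerance is a weaker property.\<close>

lemma rd_continuous_bounded:
  assumes "rd_continuous_on T K f"
  obtains B where "0 < B" "\<And>t. t \<in> K \<Longrightarrow> norm (f t) \<le> B"
proof -
  have pos: "0 < 1 / (norm l + 1)" for l :: 'a by (simp add: add_nonneg_pos)
  have ev: "\<exists>d>0. \<forall>\<^sub>F s in F. norm (f s) \<le> 1 / d" if "(f \<longlongrightarrow> l) F" for l and F :: "real filter"
  proof -
    have "\<forall>\<^sub>F s in F. norm (f s) < norm l + 1"
      using tendsto_norm[OF that] by (rule order_tendstoD) simp
    then have "\<forall>\<^sub>F s in F. norm (f s) \<le> 1 / (1 / (norm l + 1))"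
      by (rule eventually_mono) simp
    with pos show ?thesis by blast
  qed
  have "\<exists>d>0. \<forall>t\<in>K. norm (f t) \<le> 1 / d"
  proof (rule rd_local_imp_uniform)
    fix c d t assume "norm (f t) \<le> 1 / d" "0 < c" "c \<le> (d::real)"
    then show "norm (f t) \<le> 1 / c" by (smt (verit) frac_le)
  next
    fix t assume "t \<in> K"
    show "\<exists>d>0. norm (f t) \<le> 1 / d" by (rule exI[of _ "1 / (norm (f t) + 1)"]) (simp add: add_nonneg_pos)
  next
    fix t assume "t \<in> K" "right_dense T t"
    with assms show "\<exists>d>0. \<forall>\<^sub>F s in at t within K. norm (f s) \<le> 1 / d"
      by (auto simp: rd_continuous_on_def continuous_within intro: ev)
  next
    fix t assume "t \<in> K" "left_dense T t"
    with assms show "\<exists>d>0. \<forall>\<^sub>F s in at t within (K \<inter> {..<t}). norm (f s) \<le> 1 / d"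
      by (auto simp: rd_continuous_on_def intro: ev)
  qed
  then obtain d where "0 < d" "\<forall>t\<in>K. norm (f t) \<le> 1 / d" by blast
  then show ?thesis by (intro that[of "1 / d"]) auto
qed

section \<open>Antiderivatives of rd-continuous functions\<close>

text \<open>At a right-scattered point the monotone function \<open>\<sigma>\<close> jumps: to the left of the point its values do
  not exceed the point. Monotone functions have countably many discontinuities.\<close>

lemma countable_right_scattered: "countable {t\<in>T. t < \<sigma> t}"
proof (rule countable_subset)
  show "{t\<in>T. t < \<sigma> t} \<subseteq> {t. \<not> isCont \<sigma> t}"
  proof clarify
    fix t assume t: "t \<in> T" "t < \<sigma> t" "isCont \<sigma> t"
    then have "(\<sigma> \<longlongrightarrow> \<sigma> t) (at_left t)"
      by (simp add: isCont_def filterlim_at_split)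
    moreover have "\<forall>\<^sub>F s in at_left t. \<sigma> s \<le> t"
      using fwd_jump_le[OF t(1)] by (auto simp: eventually_at_filter)
    ultimately have "\<sigma> t \<le> t" by (intro tendsto_upperbound) auto
    with t show False by simp
  qed
qed (rule mono_ctble_discont[OF mono_fwd_jump])

text \<open>The last point of \<open>kappa T\<close> that is not after \<open>x\<close>. Composing with it extends a function to the real line
  as a constant on each gap, so that its ordinary integral over a gap is the graininess times
  the value at the left end of the gap. Inserting \<open>a\<close> makes the function total and monotone.\<close>

definition floor_point :: "real \<Rightarrow> real" where
  "floor_point x = Sup (insert a (K \<inter> {..x}))"

lemma floor_point_bdd: "bdd_above (insert a (K \<inter> {..x}))"
  using T_sub a_less_b by (intro bdd_aboveI[of _ b]) (auto dest: kappa_subset)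

lemma floor_point_in: "floor_point x \<in> K"
  unfolding floor_point_def
  by (rule closed_subset_contains_Sup[OF compact_imp_closed[OF compact_kappa] _ _ floor_point_bdd])
    (auto simp: a_in_kappa)

lemma floor_point_ge: "t \<in> K \<Longrightarrow> t \<le> x \<Longrightarrow> t \<le> floor_point x"
  unfolding floor_point_def by (rule cSup_upper[OF _ floor_point_bdd]) auto

lemma floor_point_le: "a \<le> x \<Longrightarrow> floor_point x \<le> x"
  unfolding floor_point_def by (rule cSup_least) auto

lemma mono_floor_point: "mono floor_point"
  unfolding floor_point_def by (intro monoI cSup_subset_mono floor_point_bdd) auto

lemma floor_point_eq: "t \<in> K \<Longrightarrow> floor_point t = t"
  using floor_point_ge[of t t] floor_point_le[of t] T_sub kappa_subset by force

lemma floor_point_gap: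
  assumes "t \<in> K" "t \<le> x" "x < \<sigma> t"
  shows "floor_point x = t"
proof -
  have "a \<le> x" using assms T_sub kappa_subset by force
  then have "\<not> t < floor_point x"
    using fwd_jump_le[OF kappa_subset[OF floor_point_in], of t x] floor_point_le[of x] assms by auto
  with floor_point_ge[OF assms(1,2)] show ?thesis by simp
qed

text \<open>The extended function is continuous away from the discontinuities of the monotone
  function \<open>floor_point\<close> and the right-scattered points, and both sets are countable.\<close>

lemma rd_continuous_measurable:
  fixes f :: "real \<Rightarrow> 'v::euclidean_space"
  assumes f: "rd_continuous_on T K f"
  shows "(\<lambda>x. f (floor_point x)) \<in> borel_measurable borel"
proof (rule borel_measurable_continuous_countable_exceptions)
  let ?X = "{x. \<not> isCont floor_point x} \<union> {t\<in>T. t < \<sigma> t}"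
  show "countable ?X"
    using mono_ctble_discont[OF mono_floor_point] countable_right_scattered by blast
  have "isCont (\<lambda>x. f (floor_point x)) x" if x: "x \<notin> ?X" for x
  proof (cases "x \<in> K")
    case True
    with x have "right_dense T x"
      using kappa_subset[OF True] fwd_jump_ge[of x] by (auto simp: right_dense_def)
    with f True have "continuous (at x within K) f" by (simp add: rd_continuous_on_def)
    moreover have "(floor_point \<longlongrightarrow> x) (at x)"
      using x floor_point_eq[OF True] by (simp add: isCont_def)
    ultimately show ?thesis
      unfolding isCont_def floor_point_eq[OF True]
      by (rule continuous_within_tendsto_compose'[OF _ floor_point_in])
  next
    case False
    then have "x \<in> - K" "open (- K)" using compact_imp_closed[OF compact_kappa] by auto
    then obtain e where e: "0 < e" "ball x e \<subseteq> - K" using open_contains_ball by blast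
    have "floor_point y = floor_point x" if "y \<in> ball x e" for y
    proof -
      have "K \<inter> {..y} = K \<inter> {..x}"
      proof -
        have "s \<le> y \<longleftrightarrow> s \<le> x" if "s \<in> K" for s
        proof (rule ccontr)
          assume "(s \<le> y) \<noteq> (s \<le> x)"
          then have "\<bar>x - s\<bar> \<le> \<bar>x - y\<bar>" by linarith
          also have "\<bar>x - y\<bar> < e" using \<open>y \<in> ball x e\<close> by (simp add: dist_real_def)
          finally have "s \<in> ball x e" by (simp add: dist_real_def)
          with e(2) that show False by blast
        qed
        then show ?thesis by auto
      qed
      then show ?thesis by (simp add: floor_point_def)
    qed
    then have const: "f (floor_point y) = f (floor_point x)" if "y \<in> ball x e" for y
      using that by metis
    have "\<forall>\<^sub>F y in nhds x. y \<in> ball x e"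
      using e(1) by (intro eventually_nhds_in_open) auto
    then have "\<forall>\<^sub>F y in nhds x. f (floor_point y) = f (floor_point x)"
      by (rule eventually_mono) (rule const)
    from isCont_cong[OF this] show ?thesis by simp
  qed
  then show "continuous_on (- ?X) (\<lambda>x. f (floor_point x))"
    by (intro continuous_at_imp_continuous_on) auto
qed

text \<open>The antiderivative is the ordinary integral of the extension that is constant on gaps. At a
  right-scattered point the integral over the gap is exact and the rest is small because the extension
  is bounded; at a right-dense point all nearby values of the extension are nearby values of \<open>f\<close>.\<close>

lemma rd_continuous_antiderivative:
  fixes f :: "real \<Rightarrow> 'v::euclidean_space"
  assumes f: "rd_continuous_on T K f"
  obtains F where "\<And>t. t \<in> K \<Longrightarrow> has_delta_deriv T F (f t) t"
proof -
  obtain B where B: "0 < B" "\<And>t. t \<in> K \<Longrightarrow> norm (f t) \<le> B"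
    using rd_continuous_bounded[OF f] by blast
  define g where "g = (\<lambda>x. f (floor_point x))"
  have gB: "norm (g x) \<le> B" for x using B(2) floor_point_in by (simp add: g_def)
  have int: "g integrable_on {c..d}" for c d
  proof (rule measurable_bounded_by_integrable_imp_integrable)
    show "g \<in> borel_measurable (lebesgue_on {c..d})"
      using rd_continuous_measurable[OF f] unfolding g_def
      by (intro measurable_restrict_space1 measurable_completion) simp
    show "(\<lambda>_. B) integrable_on {c..d}" by (rule integrable_const_ivl)
  qed (use gB in auto)
  define F where "F = (\<lambda>x. integral {a..x} g)"
  have F: "F d - F c = integral {c..d} g" if "a \<le> c" "c \<le> d" for c d
    using Henstock_Kurzweil_Integration.integral_combine[OF that int] by (simp add: F_def algebra_simps)
  have bound: "norm (F d - F c - (d - c) *\<^sub>R v) \<le> e * \<bar>d - c\<bar>"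
    if cd: "a \<le> c" "c \<le> d" and e: "0 \<le> e" "\<And>x. c \<le> x \<Longrightarrow> x < d \<Longrightarrow> norm (g x - v) \<le> e" for c d v e
  proof -
    have "((\<lambda>x. g x - v) has_integral (integral {c..d} g - (d - c) *\<^sub>R v)) (cbox c d)"
      using has_integral_diff[OF integrable_integral[OF int] has_integral_const_real[of v c d]] cd
      by simp
    from has_integral_bound_spike_finite[OF e(1) _ this, of "{d}"] e(2)
    show ?thesis using cd by (auto simp: F)
  qed
  have "has_delta_deriv T F (f t) t" if t: "t \<in> K" for t
  proof (rule has_delta_derivI)
    fix e :: real assume e: "0 < e"
    have at: "a \<le> t" "t \<in> T" using t T_sub kappa_subset by force+
    show "\<exists>d>0. \<forall>s\<in>T. \<bar>s - t\<bar> < d \<longrightarrow>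
       norm (F (\<sigma> t) - F s - (\<sigma> t - s) *\<^sub>R f t) \<le> e * \<bar>\<sigma> t - s\<bar>"
    proof (cases "right_dense T t")
      case False
      define m where "m = \<sigma> t - t"
      have m: "0 < m" using False fwd_jump_ge[of t] by (simp add: right_dense_def m_def)
      have jump: "F (\<sigma> t) - F t - (\<sigma> t - t) *\<^sub>R f t = 0"
        using bound[of t "\<sigma> t" 0 "f t"] at m floor_point_gap[OF t] by (simp add: m_def g_def)
      \<comment> \<open>The allowed error is at least \<open>e * m\<close> for every \<open>s \<le> t\<close>, because \<open>\<sigma> t\<close> stays at distance \<open>m\<close>.
        Boundedness of the integrand therefore suffices to the left of \<open>t\<close>.\<close>
      define d where "d = min m (e * m / (2 * B))"
      have "0 < d" using m e B by (simp add: d_def)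
      moreover have "norm (F (\<sigma> t) - F s - (\<sigma> t - s) *\<^sub>R f t) \<le> e * \<bar>\<sigma> t - s\<bar>"
        if s: "s \<in> T" "\<bar>s - t\<bar> < d" for s
      proof -
        have "s \<le> t" using fwd_jump_le[OF s(1), of t] s by (force simp: d_def m_def)
        have "F (\<sigma> t) - F s - (\<sigma> t - s) *\<^sub>R f t
          = (F (\<sigma> t) - F t - (\<sigma> t - t) *\<^sub>R f t) + (F t - F s - (t - s) *\<^sub>R f t)"
          by (simp add: algebra_simps)
        also have "norm \<dots> \<le> (2 * B) * \<bar>t - s\<bar>"
          unfolding jump add_0
        proof (rule bound)
          show "norm (g x - f t) \<le> 2 * B" for x
            using norm_triangle_ineq4[of "g x" "f t"] gB[of x] B(2)[OF t] by linarith
        qed (use B(1) s T_sub \<open>s \<le> t\<close> in auto)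
        also have "\<dots> \<le> e * m"
          using s B(1) by (simp add: d_def field_simps abs_minus_commute)
        also have "\<dots> \<le> e * \<bar>\<sigma> t - s\<bar>"
          using e \<open>s \<le> t\<close> by (simp add: m_def)
        finally show ?thesis .
      qed
      ultimately show ?thesis by blast
    next
      case True
      then have st: "\<sigma> t = t" by (simp add: right_dense_def)
      from f t True have "continuous (at t within K) f" by (simp add: rd_continuous_on_def)
      with e obtain d where d: "0 < d" "\<And>s. s \<in> K \<Longrightarrow> \<bar>s - t\<bar> < d \<Longrightarrow> norm (f s - f t) < e"
        unfolding continuous_within_eps_delta dist_norm real_norm_def by blast
      have "norm (F t - F s - (t - s) *\<^sub>R f t) \<le> e * \<bar>t - s\<bar>"
        if s: "s \<in> T" "\<bar>s - t\<bar> < d" for s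
      proof (cases "s \<le> t")
        case True
        show ?thesis
        proof (rule bound)
          fix x assume x: "s \<le> x" "x < t"
          then have "s \<in> K" using s t T_sub kappa_subset by (force simp: in_kappa_iff)
          with x s T_sub have "s \<le> floor_point x" "floor_point x \<le> x"
            by (auto intro!: floor_point_ge floor_point_le)
          then show "norm (g x - f t) \<le> e"
            using d(2)[OF floor_point_in, of x] x s unfolding g_def by force
        qed (use e s T_sub True in auto)
      next
        case False
        have "norm (F s - F t - (s - t) *\<^sub>R f t) \<le> e * \<bar>s - t\<bar>"
        proof (rule bound)
          fix x assume x: "t \<le> x" "x < s"
          then have "t \<le> floor_point x" "floor_point x \<le> x"
            using t at by (auto intro!: floor_point_ge floor_point_le)
          then show "norm (g x - f t) \<le> e"
            using d(2)[OF floor_point_in, of x] x s unfolding g_def by force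
        qed (use e at False in auto)
        moreover have "F s - F t - (s - t) *\<^sub>R f t = - (F t - F s - (t - s) *\<^sub>R f t)"
          by (simp add: algebra_simps)
        ultimately show ?thesis by (metis abs_minus_commute norm_minus_cancel)
      qed
      with d(1) st show ?thesis by auto
    qed
  qed
  then show ?thesis by (rule that)
qed

end

section \<open>Closure properties of rd-continuity\<close>

lemma rd_continuous_on_cong:
  assumes "\<And>t. t \<in> S \<Longrightarrow> f t = g t" "rd_continuous_on T S f"
  shows "rd_continuous_on T S g"
  unfolding rd_continuous_on_def
proof (intro ballI conjI impI)
  fix t assume t: "t \<in> S"
  {
    assume "right_dense T t"
    with assms(2) t have "continuous (at t within S) f" by (simp add: rd_continuous_on_def)
    then show "continuous (at t within S) g"
      by (rule continuous_transform_within[OF _ zero_less_one t]) (simp add: assms(1))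
  next
    assume "left_dense T t"
    with assms(2) t obtain l where "(f \<longlongrightarrow> l) (at t within (S \<inter> {..<t}))"
      by (auto simp: rd_continuous_on_def)
    then have "(g \<longlongrightarrow> l) (at t within (S \<inter> {..<t}))"
      by (rule Lim_transform_within[OF _ zero_less_one]) (simp add: assms(1))
    then show "\<exists>l. (g \<longlongrightarrow> l) (at t within (S \<inter> {..<t}))" ..
  }
qed

lemma rd_continuous_on_add:
  "rd_continuous_on T S f \<Longrightarrow> rd_continuous_on T S g \<Longrightarrow> rd_continuous_on T S (\<lambda>t. f t + g t)"
  unfolding rd_continuous_on_def by (blast intro: tendsto_add continuous_add)

lemma rd_continuous_on_diff:
  "rd_continuous_on T S f \<Longrightarrow> rd_continuous_on T S g \<Longrightarrow> rd_continuous_on T S (\<lambda>t. f t - g t)"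
  unfolding rd_continuous_on_def by (blast intro: tendsto_diff continuous_diff)

lemma rd_continuous_on_scaleR:
  "rd_continuous_on T S f \<Longrightarrow> rd_continuous_on T S (\<lambda>t. c *\<^sub>R f t)"
  unfolding rd_continuous_on_def
  by (blast intro: tendsto_scaleR[OF tendsto_const] continuous_scaleR[OF continuous_const])

lemma rd_continuous_on_inner:
  "rd_continuous_on T S f \<Longrightarrow> rd_continuous_on T S g \<Longrightarrow> rd_continuous_on T S (\<lambda>t. f t \<bullet> g t)"
  unfolding rd_continuous_on_def by (blast intro: tendsto_inner continuous_inner)

lemma rd_continuous_on_const: "rd_continuous_on T S (\<lambda>_. c)"
  unfolding rd_continuous_on_def by (blast intro: tendsto_const continuous_const)

section \<open>Gradients of a twice differentiable integrand\<close>

lemma gradient_eq: "GDERIV f x :> D \<Longrightarrow> gradient f x = D"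
  unfolding gradient_def
proof (rule the_equality)
  fix E assume "GDERIV f x :> D" "GDERIV f x :> E"
  then have "(\<lambda>h. h \<bullet> D) = (\<lambda>h. h \<bullet> E)"
    unfolding gderiv_def by (rule has_derivative_unique)
  then show "E = D" by (metis vector_eq_ldot)
qed

text \<open>The partial gradients are the Riesz representatives of the restrictions of the total derivative to
  the two factors, and depend continuously on the point because the total derivative does.\<close>

lemma class_C2_gradients:
  fixes F :: "'v::euclidean_space \<Rightarrow> 'v \<Rightarrow> real"
  assumes "class_C2 (\<lambda>(w, v). F w v)"
  shows "((\<lambda>(w, v). F w v) has_derivative
           (\<lambda>h. fst h \<bullet> gradient (\<lambda>w. F w (snd x)) (fst x)
              + snd h \<bullet> gradient (F (fst x)) (snd x))) (at x)"
    and "continuous_on UNIV (\<lambda>(w, v). gradient (\<lambda>w. F w v) w)"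
    and "continuous_on UNIV (\<lambda>(w, v). gradient (\<lambda>v. F w v) v)"
proof -
  obtain f' :: "'v \<times> 'v \<Rightarrow> ('v \<times> 'v) \<Rightarrow>\<^sub>L real" and f''
    where f': "\<And>x. ((\<lambda>(w, v). F w v) has_derivative blinfun_apply (f' x)) (at x)"
      and f'': "\<And>x. (f' has_derivative blinfun_apply (f'' x)) (at x)"
    using assms unfolding class_C2_def by blast
  have cont: "continuous_on UNIV f'"
    by (intro continuous_at_imp_continuous_on ballI has_derivative_continuous[OF f''])
  define gw where "gw = (\<lambda>x. adjoint (\<lambda>h. f' x (h, 0)) (1::real))"
  define gv where "gv = (\<lambda>x. adjoint (\<lambda>h. f' x (0, h)) (1::real))"
  have "linear (\<lambda>h. f' x (h, 0))" for x
    by (intro bounded_linear.linear bounded_linear_compose[OF blinfun.bounded_linear_right]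
      bounded_linear_Pair bounded_linear_ident bounded_linear_zero)
  from adjoint_works[OF this] have gw: "h \<bullet> gw x = f' x (h, 0)" for h x
    by (simp add: gw_def)
  have "linear (\<lambda>h. f' x (0, h))" for x
    by (intro bounded_linear.linear bounded_linear_compose[OF blinfun.bounded_linear_right]
      bounded_linear_Pair bounded_linear_zero bounded_linear_ident)
  from adjoint_works[OF this] have gv: "h \<bullet> gv x = f' x (0, h)" for h x
    by (simp add: gv_def)
  have "((\<lambda>w. F w v) has_derivative (\<lambda>h. f' (w, v) (h, 0))) (at w)" for w v
    using has_derivative_compose[OF has_derivative_Pair[OF has_derivative_ident has_derivative_const] f'[of "(w, v)"]]
    by simp
  then have eq_w: "gradient (\<lambda>w. F w v) w = gw (w, v)" for w v
    by (intro gradient_eq) (simp add: gderiv_def gw)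
  have "((\<lambda>v. F w v) has_derivative (\<lambda>h. f' (w, v) (0, h))) (at v)" for w v
    using has_derivative_compose[OF has_derivative_Pair[OF has_derivative_const has_derivative_ident] f'[of "(w, v)"]]
    by simp
  then have eq_v: "gradient (\<lambda>v. F w v) v = gv (w, v)" for w v
    by (intro gradient_eq) (simp add: gderiv_def gv)
  have "f' x h = fst h \<bullet> gw x + snd h \<bullet> gv x" for h
  proof -
    have "h = (fst h, 0) + (0, snd h)" by simp
    then have "f' x h = f' x (fst h, 0) + f' x (0, snd h)" by (metis blinfun.add_right)
    then show ?thesis by (simp add: gw gv)
  qed
  then have "blinfun_apply (f' x) = (\<lambda>h. fst h \<bullet> gw x + snd h \<bullet> gv x)" by blast
  with f'[of x] show "((\<lambda>(w, v). F w v) has_derivative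
           (\<lambda>h. fst h \<bullet> gradient (\<lambda>w. F w (snd x)) (fst x)
              + snd h \<bullet> gradient (F (fst x)) (snd x))) (at x)"
    by (simp add: eq_w eq_v)
  have "continuous_on UNIV gw"
    unfolding continuous_on_componentwise[of UNIV gw] inner_commute[of "gw _"] gw
    by (intro ballI continuous_intros cont)
  then show "continuous_on UNIV (\<lambda>(w, v). gradient (\<lambda>w. F w v) w)"
    by (simp add: eq_w)
  have "continuous_on UNIV gv"
    unfolding continuous_on_componentwise[of UNIV gv] inner_commute[of "gv _"] gv
    by (intro ballI continuous_intros cont)
  then show "continuous_on UNIV (\<lambda>(w, v). gradient (\<lambda>v. F w v) v)"
    by (simp add: eq_v)
qed

text \<open>Mean value theorem along the segment from \<open>x\<close> to \<open>x + h\<close>.\<close>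

lemma class_C2_increment:
  fixes F :: "'v::euclidean_space \<Rightarrow> 'v \<Rightarrow> real"
  assumes "class_C2 (\<lambda>(w, v). F w v)"
  obtains c where "0 < c" "c < 1"
    "(\<lambda>(w, v). F w v) (x + h) - (\<lambda>(w, v). F w v) x
       = fst h \<bullet> (\<lambda>(w, v). gradient (\<lambda>w. F w v) w) (x + c *\<^sub>R h)
       + snd h \<bullet> (\<lambda>(w, v). gradient (\<lambda>v. F w v) v) (x + c *\<^sub>R h)"
proof -
  let ?F = "\<lambda>(w, v). F w v"
  let ?d = "\<lambda>z. fst h \<bullet> (\<lambda>(w, v). gradient (\<lambda>w. F w v) w) z
       + snd h \<bullet> (\<lambda>(w, v). gradient (\<lambda>v. F w v) v) z"
  have "((\<lambda>s. ?F (x + s *\<^sub>R h)) has_real_derivative ?d (x + s *\<^sub>R h)) (at s)" for s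
  proof -
    have "((\<lambda>s. x + s *\<^sub>R h) has_derivative (\<lambda>u. u *\<^sub>R h)) (at s)"
      by (auto intro!: derivative_eq_intros)
    from has_derivative_compose[OF this class_C2_gradients(1)[OF assms]]
    show ?thesis
      unfolding has_field_derivative_def
      by (rule has_derivative_eq_rhs) (simp add: fun_eq_iff case_prod_beta algebra_simps)
  qed
  then obtain c where "0 < c" "c < 1" "?F (x + 1 *\<^sub>R h) - ?F (x + 0 *\<^sub>R h) = (1 - 0) * ?d (x + c *\<^sub>R h)"
    using MVT2[of 0 1 "\<lambda>s. ?F (x + s *\<^sub>R h)" "\<lambda>s. ?d (x + s *\<^sub>R h)"] by auto
  then show ?thesis by (intro that[of c]) auto
qed

section \<open>Evaluation along a trajectory\<close>

context compact_time_scale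
begin

lemma delta_differentiable_rd_continuous:
  assumes "\<And>t. t \<in> K \<Longrightarrow> has_delta_deriv T f (D t) t"
  shows "rd_continuous_on T K f"
  unfolding rd_continuous_on_def
proof (intro ballI conjI impI)
  fix t assume "t \<in> K"
  then have c: "continuous (at t within T) f" by (intro delta_deriv_continuous[OF assms])
  then show "continuous (at t within K) f"
    by (rule continuous_within_subset) (auto simp: kappa_eq)
  from c show "\<exists>l. (f \<longlongrightarrow> l) (at t within (K \<inter> {..<t}))"
    unfolding continuous_within by (blast intro: tendsto_within_subset kappa_subset)
qed

lemma C1_rdD:
  assumes "y \<in> C1_rd T"
  shows "\<And>t. t \<in> K \<Longrightarrow> has_delta_deriv T y (delta_deriv T y t) t"
    and "rd_continuous_on T K (delta_deriv T y)"
  using assms delta_deriv_eq unfolding C1_rd_def by blast+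

lemma C1_rdI:
  assumes "\<And>t. t \<in> K \<Longrightarrow> has_delta_deriv T y (D t) t" "rd_continuous_on T K D"
  shows "y \<in> C1_rd T"
proof -
  have "rd_continuous_on T K (delta_deriv T y)"
    by (rule rd_continuous_on_cong[OF _ assms(2)]) (simp add: delta_deriv_eq[OF assms(1)])
  with assms(1) show ?thesis by (auto simp: C1_rd_def)
qed

text \<open>The pair of arguments at which the integrand is evaluated. As an element of the product space it
  can be perturbed by a single vector, which keeps the two arguments together in all limits.\<close>

definition jet :: "(real \<Rightarrow> 'v::real_normed_vector) \<Rightarrow> real \<Rightarrow> 'v \<times> 'v" where
  "jet y t = (y (\<sigma> t), delta_deriv T y t)"

lemma along_jet: "along T g y t = (\<lambda>(w, v). g t w v) (jet y t)"
  by (simp add: along_def jet_def)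

lemma fwd_jump_tendsto_right_dense:
  assumes "right_dense T t" "t \<in> K"
  shows "(\<sigma> \<longlongrightarrow> t) (at t within K)"
  unfolding tendsto_iff eventually_at
proof (intro allI impI)
  fix e :: real assume e: "0 < e"
  have t: "t \<in> T" using assms(2) by (rule kappa_subset)
  have "\<exists>d>0. \<forall>s\<in>T. t < s \<and> s < t + d \<longrightarrow> \<sigma> s < t + e"
  proof (cases "t < b")
    case True
    then obtain u where "u \<in> T" "t < u" "u < t + e"
      using right_dense_approach[OF assms(1) t _ e] by blast
    then show ?thesis using fwd_jump_le by (intro exI[of _ "u - t"]) fastforce
  next
    case False
    with T_sub show ?thesis by (intro exI[of _ 1]) force
  qed
  then obtain d where d: "0 < d" "\<And>s. s \<in> T \<Longrightarrow> t < s \<Longrightarrow> s < t + d \<Longrightarrow> \<sigma> s < t + e"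
    by blast
  have "dist (\<sigma> s) t < e" if "s \<in> K" "s \<noteq> t" "dist s t < min d e" for s
    using that d(2)[of s] kappa_subset[of s] fwd_jump_ge[of s] fwd_jump_le[OF t, of s]
    by (cases "s < t") (auto simp: dist_real_def)
  with d(1) e show "\<exists>d>0. \<forall>s\<in>K. s \<noteq> t \<and> dist s t < d \<longrightarrow> dist (\<sigma> s) t < e"
    by (intro exI[of _ "min d e"]) auto
qed

lemma fwd_jump_tendsto_left:
  assumes "t \<in> T"
  shows "(\<sigma> \<longlongrightarrow> t) (at t within (S \<inter> {..<t}))"
proof (rule tendsto_sandwich)
  show "\<forall>\<^sub>F s in at t within (S \<inter> {..<t}). s \<le> \<sigma> s" by (simp add: fwd_jump_ge)
  show "\<forall>\<^sub>F s in at t within (S \<inter> {..<t}). \<sigma> s \<le> t"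
    using fwd_jump_le[OF assms] by (auto simp: eventually_at_filter)
qed (auto intro: tendsto_ident_at)

lemma jet_tendsto:
  assumes y: "y \<in> C1_rd T" and t: "t \<in> K"
  shows "right_dense T t \<Longrightarrow> (jet y \<longlongrightarrow> jet y t) (at t within K)"
    and "left_dense T t \<Longrightarrow> \<exists>x. (jet y \<longlongrightarrow> x) (at t within (K \<inter> {..<t}))"
proof -
  have c: "continuous (at t within T) y"
    using delta_deriv_continuous C1_rdD(1)[OF y t] t by blast
  have ev: "\<forall>\<^sub>F s in at t within S. \<sigma> s \<in> T" if "S \<subseteq> K" for S
    unfolding eventually_at_filter
    using that kappa_subset fwd_jump_in by (intro always_eventually) blast
  {
    assume rd: "right_dense T t"
    then have "(delta_deriv T y \<longlongrightarrow> delta_deriv T y t) (at t within K)"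
      using C1_rdD(2)[OF y] t by (auto simp: rd_continuous_on_def continuous_within)
    moreover have "((\<lambda>s. y (\<sigma> s)) \<longlongrightarrow> y (\<sigma> t)) (at t within K)"
      using continuous_within_tendsto_compose[OF c ev fwd_jump_tendsto_right_dense[OF rd t]] rd
      by (simp add: right_dense_def)
    ultimately show "(jet y \<longlongrightarrow> jet y t) (at t within K)"
      unfolding jet_def by (intro tendsto_Pair)
  next
    assume ld: "left_dense T t"
    then obtain l where "(delta_deriv T y \<longlongrightarrow> l) (at t within (K \<inter> {..<t}))"
      using C1_rdD(2)[OF y] t by (auto simp: rd_continuous_on_def)
    moreover have "((\<lambda>s. y (\<sigma> s)) \<longlongrightarrow> y t) (at t within (K \<inter> {..<t}))"
      using continuous_within_tendsto_compose[OF c ev fwd_jump_tendsto_left[OF kappa_subset[OF t]]]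
      by simp
    ultimately have "(jet y \<longlongrightarrow> (y t, l)) (at t within (K \<inter> {..<t}))"
      unfolding jet_def by (intro tendsto_Pair)
    then show "\<exists>x. (jet y \<longlongrightarrow> x) (at t within (K \<inter> {..<t}))" ..
  }
qed

text \<open>The limits are taken jointly in time and in a perturbation of the trajectory. At a left-dense point
  the trajectory itself may have a limit different from its value there, and the integrand may have a
  limit different from its value; joint rd-continuity provides a limit at every point of the product
  space, in particular at the limit of the trajectory.\<close>

lemma perturbed_tendsto:
  fixes g :: "real \<Rightarrow> 'v::real_normed_vector \<Rightarrow> 'v \<Rightarrow> 'b::real_normed_vector"
  assumes g: "jointly_rd_continuous T g" and y: "y \<in> C1_rd T" and t: "t \<in> K"
  defines "G \<equiv> \<lambda>(s, h). (\<lambda>(w, v). g s w v) (jet y s + h)"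
  shows "right_dense T t \<Longrightarrow> (G \<longlongrightarrow> G (t, 0)) ((at t within K) \<times>\<^sub>F nhds 0)"
    and "left_dense T t \<Longrightarrow> \<exists>l. (G \<longlongrightarrow> l) ((at t within (K \<inter> {..<t})) \<times>\<^sub>F nhds 0)"
proof -
  have G: "G z = (\<lambda>(s, w, v). g s w v) (fst z, jet y (fst z) + snd z)" for z
    by (simp add: G_def case_prod_beta)
  have lim: "((\<lambda>z. (fst z, jet y (fst z) + snd z)) \<longlongrightarrow> (t, x)) ((at t within S) \<times>\<^sub>F nhds 0)"
    if "(jet y \<longlongrightarrow> x) (at t within S)" for S x
  proof (intro tendsto_Pair)
    have "filterlim fst (at t within S) ((at t within S) \<times>\<^sub>F nhds (0 :: 'v \<times> 'v))"
      by (rule filterlim_fst)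
    then show "(fst \<longlongrightarrow> t) ((at t within S) \<times>\<^sub>F nhds (0 :: 'v \<times> 'v))"
      and "((\<lambda>z. jet y (fst z) + snd z) \<longlongrightarrow> x) ((at t within S) \<times>\<^sub>F nhds (0 :: 'v \<times> 'v))"
      using filterlim_compose[OF tendsto_ident_at] tendsto_add[OF filterlim_compose[OF that] filterlim_snd]
      by (blast, fastforce)
  qed
  have ev: "\<forall>\<^sub>F z in (at t within S) \<times>\<^sub>F nhds (0 :: 'v \<times> 'v). fst z \<in> S \<and> fst z \<noteq> t" for S
    by (rule eventually_compose_filterlim[OF _ filterlim_fst]) (simp add: eventually_at_filter)
  obtain w v where wv: "jet y t = (w, v)" by fastforce
  {
    assume rd: "right_dense T t"
    with g kappa_subset[OF t]
    have "continuous (at (t, jet y t) within (T \<times> UNIV)) (\<lambda>(t, w, v). g t w v)"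
      by (simp add: jointly_rd_continuous_def wv)
    from continuous_within_tendsto_compose[OF this _ lim[OF jet_tendsto(1)[OF y t rd]]]
    have "((\<lambda>z. (\<lambda>(s, w, v). g s w v) (fst z, jet y (fst z) + snd z)) \<longlongrightarrow>
        (\<lambda>(s, w, v). g s w v) (t, jet y t)) ((at t within K) \<times>\<^sub>F nhds 0)"
      using eventually_mono[OF ev[of K]] kappa_subset by (auto simp: mem_Times_iff)
    then show "(G \<longlongrightarrow> G (t, 0)) ((at t within K) \<times>\<^sub>F nhds 0)"
      unfolding G[abs_def] by simp
  next
    assume ld: "left_dense T t"
    then obtain x where x: "(jet y \<longlongrightarrow> x) (at t within (K \<inter> {..<t}))"
      using jet_tendsto(2)[OF y t] by blast
    obtain w' v' where "x = (w', v')" by fastforce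
    with ld g kappa_subset[OF t] obtain l
      where l: "((\<lambda>(t, w, v). g t w v) \<longlongrightarrow> l) (at (t, x) within ((T \<inter> {..<t}) \<times> UNIV))"
      unfolding jointly_rd_continuous_def by blast
    have "filterlim (\<lambda>z. (fst z, jet y (fst z) + snd z)) (at (t, x) within ((T \<inter> {..<t}) \<times> UNIV))
        ((at t within (K \<inter> {..<t})) \<times>\<^sub>F nhds 0)"
      unfolding filterlim_at
    proof (rule conjI[OF _ lim[OF x]])
      show "\<forall>\<^sub>F z in (at t within (K \<inter> {..<t})) \<times>\<^sub>F nhds 0.
          (fst z, jet y (fst z) + snd z) \<in> (T \<inter> {..<t}) \<times> UNIV \<and>
          (fst z, jet y (fst z) + snd z) \<noteq> (t, x)"
        by (rule eventually_mono[OF ev]) (auto dest: kappa_subset)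
    qed
    from filterlim_compose[OF l this] have "(G \<longlongrightarrow> l) ((at t within (K \<inter> {..<t})) \<times>\<^sub>F nhds 0)"
      unfolding G[abs_def] .
    then show "\<exists>l. (G \<longlongrightarrow> l) ((at t within (K \<inter> {..<t})) \<times>\<^sub>F nhds 0)" ..
  }
qed

lemma along_rd_continuous:
  assumes g: "jointly_rd_continuous T g" and y: "y \<in> C1_rd T"
  shows "rd_continuous_on T K (along T g y)"
proof -
  have zero: "filterlim (\<lambda>s. (s, 0)) (F \<times>\<^sub>F nhds (0 :: (real ^ 'n) \<times> (real ^ 'n))) F" for F :: "real filter"
    by (intro filterlim_Pair filterlim_ident tendsto_const)
  show ?thesis
    unfolding rd_continuous_on_def continuous_within
  proof (intro ballI conjI impI)
    fix t assume t: "t \<in> K"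
    {
      assume "right_dense T t"
      from filterlim_compose[OF perturbed_tendsto(1)[OF g y t this] zero]
      show "(along T g y \<longlongrightarrow> along T g y t) (at t within K)"
        by (simp add: along_jet[abs_def])
    next
      assume "left_dense T t"
      from perturbed_tendsto(2)[OF g y t this] filterlim_compose[OF _ zero]
      show "\<exists>l. (along T g y \<longlongrightarrow> l) (at t within (K \<inter> {..<t}))"
        by (fastforce simp: along_jet[abs_def])
    }
  qed
qed

text \<open>Near a dense point, both the perturbed and the unperturbed value are close to the joint limit
  and so to each other, although neither need be close to the value at that point. At the
  point itself the continuity of \<open>g\<close> for fixed time is used; it is needed because the
  joint limits say nothing about the value at a right-scattered point.\<close>

lemma along_uniformly_continuous:
  fixes g :: "real \<Rightarrow> 'v::real_normed_vector \<Rightarrow> 'v \<Rightarrow> 'b::real_normed_vector"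
  assumes g: "jointly_rd_continuous T g" and y: "y \<in> C1_rd T"
    and cont: "\<And>t. t \<in> K \<Longrightarrow> continuous_on UNIV (\<lambda>(w, v). g t w v)" and e: "0 < e"
  shows "\<exists>d>0. \<forall>t\<in>K. \<forall>h. norm h < d \<longrightarrow>
    norm ((\<lambda>(w, v). g t w v) (jet y t + h) - (\<lambda>(w, v). g t w v) (jet y t)) \<le> e"
proof -
  define G where "G = (\<lambda>(s, h). (\<lambda>(w, v). g s w v) (jet y s + h))"
  have ev: "\<exists>d>0. \<forall>\<^sub>F s in F. \<forall>h. norm h < d \<longrightarrow> norm (G (s, h) - G (s, 0)) \<le> e"
    if "(G \<longlongrightarrow> l) (F \<times>\<^sub>F nhds 0)" for l and F :: "real filter"
  proof -
    from that have "\<forall>\<^sub>F z in F \<times>\<^sub>F nhds 0. dist (G z) l < e / 2"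
      using e by (intro tendstoD) auto
    then obtain P Q where PQ: "eventually P F" "eventually Q (nhds 0)"
        "\<And>s h. P s \<Longrightarrow> Q h \<Longrightarrow> dist (G (s, h)) l < e / 2"
      unfolding eventually_prod_filter by blast
    from PQ(2) obtain d where d: "0 < d" "\<And>h. norm h < d \<Longrightarrow> Q h"
      unfolding eventually_nhds_metric by (auto simp: dist_norm)
    have "norm (G (s, h) - G (s, 0)) \<le> e" if "P s" "norm h < d" for s h
      using dist_triangle_half_l[OF PQ(3)[OF that(1) d(2)[OF that(2)]] PQ(3)[OF that(1) d(2)[of 0]]] d(1)
      by (simp add: dist_norm)
    with d(1) PQ(1) show ?thesis by (blast intro: eventually_mono)
  qed
  have "\<exists>d>0. \<forall>t\<in>K. \<forall>h. norm h < d \<longrightarrow> norm (G (t, h) - G (t, 0)) \<le> e"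
  proof (rule rd_local_imp_uniform)
    fix t assume t: "t \<in> K"
    have "continuous_on UNIV (\<lambda>h. G (t, h))"
      unfolding G_def prod.case
      by (rule continuous_on_compose2[OF cont[OF t]]) (auto intro: continuous_intros)
    then have "isCont (\<lambda>h. G (t, h)) 0"
      unfolding continuous_on_eq_continuous_at[OF open_UNIV] by blast
    then obtain d where "0 < d" "\<forall>h. dist h 0 < d \<longrightarrow> dist (G (t, h)) (G (t, 0)) < e"
      using e unfolding continuous_at_eps_delta by blast
    then show "\<exists>d>0. \<forall>h. norm h < d \<longrightarrow> norm (G (t, h) - G (t, 0)) \<le> e"
      by (intro exI[of _ d]) (auto simp: dist_norm intro: less_imp_le)
  next
    fix t assume "t \<in> K" "right_dense T t"
    from perturbed_tendsto(1)[OF g y this]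
    show "\<exists>d>0. \<forall>\<^sub>F s in at t within K. \<forall>h. norm h < d \<longrightarrow> norm (G (s, h) - G (s, 0)) \<le> e"
      unfolding G_def[symmetric] by (rule ev)
  next
    fix t assume "t \<in> K" "left_dense T t"
    from perturbed_tendsto(2)[OF g y this]
    show "\<exists>d>0. \<forall>\<^sub>F s in at t within (K \<inter> {..<t}). \<forall>h. norm h < d \<longrightarrow> norm (G (s, h) - G (s, 0)) \<le> e"
      unfolding G_def[symmetric] by (blast intro: ev)
  qed auto
  then show ?thesis by (simp add: G_def)
qed

section \<open>The first variation\<close>

lemma C1_rd_add_scaleR:
  assumes "y \<in> C1_rd T" "\<eta> \<in> C1_rd T"
  shows "(\<lambda>t. y t + c *\<^sub>R \<eta> t) \<in> C1_rd T"
proof (rule C1_rdI)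
  show "has_delta_deriv T (\<lambda>t. y t + c *\<^sub>R \<eta> t) (delta_deriv T y t + c *\<^sub>R delta_deriv T \<eta> t) t"
    if "t \<in> K" for t
    using that by (intro has_delta_deriv_add has_delta_deriv_scaleR C1_rdD(1) assms)
  show "rd_continuous_on T K (\<lambda>t. delta_deriv T y t + c *\<^sub>R delta_deriv T \<eta> t)"
    by (intro rd_continuous_on_add rd_continuous_on_scaleR C1_rdD(2) assms)
qed

lemma jet_add_scaleR:
  assumes "y \<in> C1_rd T" "\<eta> \<in> C1_rd T" "t \<in> K"
  shows "jet (\<lambda>t. y t + c *\<^sub>R \<eta> t) t = jet y t + c *\<^sub>R jet \<eta> t"
  unfolding jet_def
  by (simp add: delta_deriv_eq[OF has_delta_deriv_add[OF C1_rdD(1)[OF assms(1)]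
        has_delta_deriv_scaleR[OF C1_rdD(1)[OF assms(2)]]]] assms(3))

text \<open>Bounds on \<open>\<eta>\<close> over \<open>kappa T\<close> do not cover \<open>\<eta> (\<sigma> t)\<close> when \<open>\<sigma> t\<close> is an isolated maximum. The jump formula
  bounds this value through \<open>\<eta> t\<close> and the derivative.\<close>

lemma jet_bounded:
  assumes \<eta>: "\<eta> \<in> C1_rd T"
  obtains M where "0 < M" "\<And>t. t \<in> K \<Longrightarrow> norm (jet \<eta> t) \<le> M"
    "\<And>c. C1_rd_norm T (\<lambda>t. c *\<^sub>R \<eta> t) \<le> \<bar>c\<bar> * M"
proof -
  obtain B where B: "0 < B" "\<And>t. t \<in> K \<Longrightarrow> norm (\<eta> t) \<le> B"
    using rd_continuous_bounded[OF delta_differentiable_rd_continuous[OF C1_rdD(1)[OF \<eta>]]] by blast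
  obtain B' where B': "0 < B'" "\<And>t. t \<in> K \<Longrightarrow> norm (delta_deriv T \<eta> t) \<le> B'"
    using rd_continuous_bounded[OF C1_rdD(2)[OF \<eta>]] by blast
  define M where "M = B + (b - a) * B' + B'"
  have "norm (jet \<eta> t) \<le> M" if t: "t \<in> K" for t
  proof -
    have \<sigma>: "\<sigma> t \<in> T" "t \<in> T" using fwd_jump_in kappa_subset t by auto
    have "norm (\<eta> (\<sigma> t)) \<le> norm (\<eta> t) + norm ((\<sigma> t - t) *\<^sub>R delta_deriv T \<eta> t)"
      unfolding delta_deriv_fwd_jump[OF C1_rdD(1)[OF \<eta> t] t] by (rule norm_triangle_ineq)
    also have "\<dots> \<le> B + (b - a) * B'"
    proof -
      have "\<sigma> t \<in> {a..b}" "t \<in> {a..b}" using \<sigma> T_sub by blast+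
      then have "\<bar>\<sigma> t - t\<bar> \<le> b - a" by (simp add: abs_le_iff)
      then show ?thesis
        unfolding norm_scaleR using a_less_b B(2)[OF t] B'(2)[OF t]
        by (intro add_mono mult_mono) auto
    qed
    finally have "norm (\<eta> (\<sigma> t)) \<le> B + (b - a) * B'" .
    with B'(2)[OF t] have "norm (\<eta> (\<sigma> t)) + norm (delta_deriv T \<eta> t) \<le> M"
      by (simp add: M_def)
    with norm_Pair_le[of "\<eta> (\<sigma> t)" "delta_deriv T \<eta> t"] show ?thesis by (simp add: jet_def)
  qed
  moreover have "C1_rd_norm T (\<lambda>t. c *\<^sub>R \<eta> t) \<le> \<bar>c\<bar> * M" for c
  proof -
    have ne: "K \<noteq> {}" using a_in_kappa by auto
    have "(SUP t\<in>K. norm (c *\<^sub>R \<eta> t)) \<le> \<bar>c\<bar> * B"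
      using B(2) by (intro cSUP_least[OF ne]) (auto intro: mult_left_mono)
    moreover have "delta_deriv T (\<lambda>t. c *\<^sub>R \<eta> t) t = c *\<^sub>R delta_deriv T \<eta> t" if "t \<in> K" for t
      using that by (intro delta_deriv_eq has_delta_deriv_scaleR C1_rdD(1)[OF \<eta>])
    then have "(SUP t\<in>K. norm (delta_deriv T (\<lambda>t. c *\<^sub>R \<eta> t) t)) \<le> \<bar>c\<bar> * B'"
      using B'(2) by (intro cSUP_least[OF ne]) (auto intro: mult_left_mono)
    moreover have "0 \<le> \<bar>c\<bar> * ((b - a) * B')" using a_less_b B'(1) by simp
    ultimately show ?thesis unfolding C1_rd_norm_def M_def distrib_left by linarith
  qed
  moreover have "0 < M" using B(1) B'(1) a_less_b by (simp add: M_def add_pos_pos)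
  ultimately show ?thesis using that by blast
qed

text \<open>For small \<open>c > 0\<close> the mean value theorem bounds the increment of the integrand under the variation
  \<open>c *\<^sub>R \<eta>\<close> by \<open>c\<close> times its linearization plus \<open>c\<close> times an arbitrarily small constant, uniformly in
  time. Comparing antiderivatives carries this bound over to the functional, whose increment is nonnegative;
  dividing by \<open>c\<close> leaves the linearization.\<close>

lemma first_variation_nonneg:
  fixes L :: "'n::finite lagrangian"
  assumes C2: "\<And>t. t \<in> T \<Longrightarrow> class_C2 (\<lambda>(w, v). L t w v)"
    and gw: "jointly_rd_continuous T (grad_w L)" and gv: "jointly_rd_continuous T (grad_v L)"
    and min: "weak_local_minimizer T a b L ya yb y"
    and \<eta>: "\<eta> \<in> C1_rd T" "ya \<noteq> None \<Longrightarrow> \<eta> a = 0" "yb \<noteq> None \<Longrightarrow> \<eta> b = 0"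
    and H: "\<And>t. t \<in> K \<Longrightarrow> has_delta_deriv T H
      (along T (grad_w L) y t \<bullet> \<eta> (\<sigma> t) + along T (grad_v L) y t \<bullet> delta_deriv T \<eta> t) t"
  shows "H a \<le> H b"
proof (rule field_le_epsilon)
  fix e :: real assume "0 < e"
  from min obtain \<delta> where y: "y \<in> C1_rd T" "satisfies_bc a b ya yb y" and \<delta>: "0 < \<delta>"
    and m: "\<And>z. z \<in> C1_rd T \<Longrightarrow> satisfies_bc a b ya yb z \<Longrightarrow> C1_rd_norm T (\<lambda>t. z t - y t) < \<delta> \<Longrightarrow>
        (\<exists>I. has_delta_integral T (along T L z) a b I) \<and>
        delta_integral T (along T L y) a b \<le> delta_integral T (along T L z) a b"
    unfolding weak_local_minimizer_def by blast
  obtain M where M: "0 < M" "\<And>t. t \<in> K \<Longrightarrow> norm (jet \<eta> t) \<le> M"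
    "\<And>c. C1_rd_norm T (\<lambda>t. c *\<^sub>R \<eta> t) \<le> \<bar>c\<bar> * M"
    using jet_bounded[OF \<eta>(1)] by blast
  \<comment> \<open>Each of the two gradients contributes an error of at most \<open>k * M\<close> to the integrand, hence
    \<open>k * M * (b - a)\<close> to the integral; together they contribute \<open>e\<close>.\<close>
  define k where "k = e / (2 * M * (b - a))"
  have k: "0 < k" using \<open>0 < e\<close> M(1) a_less_b by (simp add: k_def)
  have cont: "continuous_on UNIV (\<lambda>(w, v). grad_w L t w v)"
    "continuous_on UNIV (\<lambda>(w, v). grad_v L t w v)" if "t \<in> K" for t
    using class_C2_gradients(2,3)[OF C2[OF kappa_subset[OF that]]] by (simp_all add: grad_w_def grad_v_def)
  obtain d1 where d1: "0 < d1" "\<And>t h. t \<in> K \<Longrightarrow> norm h < d1 \<Longrightarrow>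
    norm ((\<lambda>(w, v). grad_w L t w v) (jet y t + h) - along T (grad_w L) y t) \<le> k"
    using along_uniformly_continuous[OF gw y(1) cont(1) k] unfolding along_jet by blast
  obtain d2 where d2: "0 < d2" "\<And>t h. t \<in> K \<Longrightarrow> norm h < d2 \<Longrightarrow>
    norm ((\<lambda>(w, v). grad_v L t w v) (jet y t + h) - along T (grad_v L) y t) \<le> k"
    using along_uniformly_continuous[OF gv y(1) cont(2) k] unfolding along_jet by blast
  define c where "c = min \<delta> (min d1 d2) / (2 * M)"
  have c: "0 < c" "c * M < \<delta>" "c * M < d1" "c * M < d2"
    using \<delta> d1(1) d2(1) M(1) by (auto simp: c_def)
  define z where "z = (\<lambda>t. y t + c *\<^sub>R \<eta> t)"
  have z: "z \<in> C1_rd T" unfolding z_def by (rule C1_rd_add_scaleR[OF y(1) \<eta>(1)])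
  have bc: "satisfies_bc a b ya yb z"
    using y(2) \<eta>(2,3) by (auto simp: satisfies_bc_def z_def)
  have "C1_rd_norm T (\<lambda>t. z t - y t) < \<delta>"
    using M(3)[of c] c by (simp add: z_def)
  from m[OF z bc this] obtain J where J: "has_delta_integral T (along T L z) a b J"
    "delta_integral T (along T L y) a b \<le> delta_integral T (along T L z) a b" by blast
  \<comment> \<open>The minimizer itself is a competitor, so its integral exists as well.\<close>
  have "C1_rd_norm T (\<lambda>t. y t - y t) < \<delta>"
    using M(3)[of 0] \<delta> by simp
  from m[OF y this] obtain I where I: "has_delta_integral T (along T L y) a b I" by blast
  from I obtain F0 where F0: "\<And>t. t \<in> K \<Longrightarrow> has_delta_deriv T F0 (along T L y t) t" "I = F0 b - F0 a"
    unfolding has_delta_integral_def by blast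
  from J(1) obtain F1 where F1: "\<And>t. t \<in> K \<Longrightarrow> has_delta_deriv T F1 (along T L z t) t" "J = F1 b - F1 a"
    unfolding has_delta_integral_def by blast
  have "I \<le> J" using J(2) by (simp add: delta_integral_eq[OF I] delta_integral_eq[OF J(1)])
  let ?h = "\<lambda>t. along T (grad_w L) y t \<bullet> \<eta> (\<sigma> t) + along T (grad_v L) y t \<bullet> delta_deriv T \<eta> t"
  have le: "along T L z t - along T L y t \<le> c * (?h t + 2 * k * M)" if t: "t \<in> K" for t
  proof -
    obtain s where s: "0 < s" "s < 1" and inc:
      "(\<lambda>(w, v). L t w v) (jet y t + c *\<^sub>R jet \<eta> t) - (\<lambda>(w, v). L t w v) (jet y t)
       = fst (c *\<^sub>R jet \<eta> t) \<bullet> (\<lambda>(w, v). grad_w L t w v) (jet y t + s *\<^sub>R c *\<^sub>R jet \<eta> t)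
       + snd (c *\<^sub>R jet \<eta> t) \<bullet> (\<lambda>(w, v). grad_v L t w v) (jet y t + s *\<^sub>R c *\<^sub>R jet \<eta> t)"
      using class_C2_increment[OF C2[OF kappa_subset[OF t]]]
      unfolding grad_w_def grad_v_def by blast
    define p where "p = (\<lambda>(w, v). grad_w L t w v) (jet y t + s *\<^sub>R c *\<^sub>R jet \<eta> t)"
    define q where "q = (\<lambda>(w, v). grad_v L t w v) (jet y t + s *\<^sub>R c *\<^sub>R jet \<eta> t)"
    have "norm (s *\<^sub>R c *\<^sub>R jet \<eta> t) = s * (c * norm (jet \<eta> t))" using s c by simp
    also have "\<dots> \<le> 1 * (c * M)" using s c M(1) M(2)[OF t] by (intro mult_mono) auto
    finally have "norm (s *\<^sub>R c *\<^sub>R jet \<eta> t) \<le> c * M" by simp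
    then have pq: "norm (p - along T (grad_w L) y t) \<le> k" "norm (q - along T (grad_v L) y t) \<le> k"
      using d1(2)[OF t] d2(2)[OF t] c by (auto simp: p_def q_def)
    have fs: "norm (\<eta> (\<sigma> t)) \<le> M" "norm (delta_deriv T \<eta> t) \<le> M"
      using M(2)[OF t] norm_fst_le[of "\<eta> (\<sigma> t)" "delta_deriv T \<eta> t"]
        norm_snd_le[of "delta_deriv T \<eta> t" "\<eta> (\<sigma> t)"] by (auto simp: jet_def)
    have "along T L z t - along T L y t = c * (p \<bullet> \<eta> (\<sigma> t) + q \<bullet> delta_deriv T \<eta> t)"
      unfolding along_jet z_def jet_add_scaleR[OF y(1) \<eta>(1) t] inc p_def[symmetric] q_def[symmetric]
      by (simp add: jet_def inner_commute algebra_simps)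
    moreover have "p \<bullet> \<eta> (\<sigma> t) \<le> along T (grad_w L) y t \<bullet> \<eta> (\<sigma> t) + k * M"
    proof -
      have "(p - along T (grad_w L) y t) \<bullet> \<eta> (\<sigma> t) \<le> k * M"
        by (rule order_trans[OF norm_cauchy_schwarz]) (use pq fs k in \<open>auto intro!: mult_mono\<close>)
      then show ?thesis by (simp add: inner_diff_left)
    qed
    moreover have "q \<bullet> delta_deriv T \<eta> t \<le> along T (grad_v L) y t \<bullet> delta_deriv T \<eta> t + k * M"
    proof -
      have "(q - along T (grad_v L) y t) \<bullet> delta_deriv T \<eta> t \<le> k * M"
        by (rule order_trans[OF norm_cauchy_schwarz]) (use pq fs k in \<open>auto intro!: mult_mono\<close>)
      then show ?thesis by (simp add: inner_diff_left)
    qed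
    ultimately show ?thesis using c(1) by (simp add: mult_left_mono)
  qed
  \<comment> \<open>The constant error is integrated by the affine function \<open>(t - a) *\<^sub>R (2 * k * M)\<close>.\<close>
  have "(F1 b - F0 b) - (F1 a - F0 a)
      \<le> c *\<^sub>R (H b + (b - a) *\<^sub>R (2 * k * M)) - c *\<^sub>R (H a + (a - a) *\<^sub>R (2 * k * M))"
    using le
    by (intro delta_increment_le[OF has_delta_deriv_diff[OF F1(1) F0(1)]
          has_delta_deriv_scaleR[OF has_delta_deriv_add[OF H has_delta_deriv_affine]]]) auto
  also have "\<dots> = c * (H b - H a + e)"
    using M(1) a_less_b by (simp add: k_def field_simps)
  finally have "0 \<le> c * (H b - H a + e)" using \<open>I \<le> J\<close> F0(2) F1(2) by simp
  with c(1) show "H a \<le> H b + e" by (simp add: zero_le_mult_iff)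
qed

text \<open>If \<open>\<eta>\<close> keeps the boundary conditions, so does \<open>- \<eta>\<close>, which gives the reverse inequality.\<close>

lemma first_variation:
  fixes L :: "'n::finite lagrangian"
  assumes C2: "\<And>t. t \<in> T \<Longrightarrow> class_C2 (\<lambda>(w, v). L t w v)"
    and gw: "jointly_rd_continuous T (grad_w L)" and gv: "jointly_rd_continuous T (grad_v L)"
    and min: "weak_local_minimizer T a b L ya yb y"
    and \<eta>: "\<And>t. t \<in> K \<Longrightarrow> has_delta_deriv T \<eta> (D t) t" "rd_continuous_on T K D"
      "ya \<noteq> None \<Longrightarrow> \<eta> a = 0" "yb \<noteq> None \<Longrightarrow> \<eta> b = 0"
    and H: "\<And>t. t \<in> K \<Longrightarrow> has_delta_deriv T H
      (along T (grad_w L) y t \<bullet> \<eta> (\<sigma> t) + along T (grad_v L) y t \<bullet> D t) t"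
  shows "H a = H b"
proof (rule antisym)
  show "H a \<le> H b"
    using H by (intro first_variation_nonneg[OF C2 gw gv min C1_rdI[OF \<eta>(1,2)] \<eta>(3,4)])
      (auto simp: delta_deriv_eq[OF \<eta>(1)])
  have neg: "has_delta_deriv T (\<lambda>t. -1 *\<^sub>R \<eta> t) (-1 *\<^sub>R D t) t" if "t \<in> K" for t
    by (rule has_delta_deriv_scaleR[OF \<eta>(1)[OF that]])
  have "(- 1) *\<^sub>R H a \<le> (- 1) *\<^sub>R H b"
  proof (rule first_variation_nonneg[OF C2 gw gv min])
    show "(\<lambda>t. -1 *\<^sub>R \<eta> t) \<in> C1_rd T"
      by (rule C1_rdI[OF neg rd_continuous_on_scaleR[OF \<eta>(2)]])
    show "has_delta_deriv T (\<lambda>t. (- 1) *\<^sub>R H t)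
      (along T (grad_w L) y t \<bullet> (-1 *\<^sub>R \<eta> (\<sigma> t)) + along T (grad_v L) y t \<bullet> delta_deriv T (\<lambda>t. -1 *\<^sub>R \<eta> t) t) t"
      if "t \<in> K" for t
      using has_delta_deriv_scaleR[OF H[OF that], of "-1"] by (simp add: delta_deriv_eq[OF neg[OF that] that, simplified])
  qed (auto simp: \<eta>(3,4))
  then show "H b \<le> H a" by simp
qed


text \<open>Such an antiderivative is monotone with equal end values, hence constant on \<open>T\<close>, and derivatives
  are unique on \<open>kappa T\<close>. This replaces the usual argument that a continuous function which is
  positive somewhere has positive integral.\<close>

lemma nonneg_deriv_equal_ends_imp_zero:
  assumes F: "\<And>t. t \<in> K \<Longrightarrow> has_delta_deriv T F (f t) t" and f: "\<And>t. t \<in> K \<Longrightarrow> 0 \<le> f t"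
    and eq: "F a = (F b :: real)" and t: "t \<in> K"
  shows "f t = 0"
proof -
  have const: "F s = F a" if "s \<in> T" for s
    using nonneg_deriv_imp_mono[OF F f, of a s] nonneg_deriv_imp_mono[OF F f, of s b] that a_in b_in T_sub eq by force
  have "has_delta_deriv T F 0 t"
    using kappa_subset[OF t] fwd_jump_in
    by (intro has_delta_derivI exI[of _ 1]) (simp add: const)
  with has_delta_deriv_unique[OF F] t show ?thesis by blast
qed

section \<open>The Euler-Lagrange equation and the natural boundary conditions\<close>

text \<open>The variation whose derivative is \<open>q - P - c\<close> turns the first variation into the integral of the
  square of that derivative. The additive constant is absorbed into the antiderivative.\<close>

lemma du_bois_reymond:
  fixes L :: "'n::finite lagrangian"
  assumes C2: "\<And>t. t \<in> T \<Longrightarrow> class_C2 (\<lambda>(w, v). L t w v)"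
    and gw: "jointly_rd_continuous T (grad_w L)" and gv: "jointly_rd_continuous T (grad_v L)"
    and min: "weak_local_minimizer T a b L ya yb y"
  obtains P where "\<And>t. t \<in> K \<Longrightarrow> has_delta_deriv T P (along T (grad_w L) y t) t"
    "\<And>t. t \<in> K \<Longrightarrow> along T (grad_v L) y t = P t"
proof -
  have y: "y \<in> C1_rd T" using min by (simp add: weak_local_minimizer_def)
  let ?p = "along T (grad_w L) y" and ?q = "along T (grad_v L) y"
  obtain P where P: "\<And>t. t \<in> K \<Longrightarrow> has_delta_deriv T P (?p t) t"
    using rd_continuous_antiderivative[OF along_rd_continuous[OF gw y]] by blast
  have qP: "rd_continuous_on T K (\<lambda>t. ?q t - P t)"
    by (intro rd_continuous_on_diff along_rd_continuous[OF gv y]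
      delta_differentiable_rd_continuous[OF P])
  then obtain \<Phi> where \<Phi>: "\<And>t. t \<in> K \<Longrightarrow> has_delta_deriv T \<Phi> (?q t - P t) t"
    using rd_continuous_antiderivative by blast
  \<comment> \<open>The mean value of \<open>q - P\<close>; it makes \<open>\<eta> b = 0\<close>.\<close>
  define c where "c = (1 / (b - a)) *\<^sub>R (\<Phi> b - \<Phi> a)"
  define D where "D = (\<lambda>t. ?q t - P t - c)"
  define \<eta> where "\<eta> = (\<lambda>t. (\<Phi> t - \<Phi> a) - (t - a) *\<^sub>R c)"
  have D: "rd_continuous_on T K D"
    unfolding D_def by (intro rd_continuous_on_diff[OF qP] rd_continuous_on_const)
  have \<eta>: "has_delta_deriv T \<eta> (D t) t" if "t \<in> K" for t
    using has_delta_deriv_diff[OF has_delta_deriv_diff[OF \<Phi>[OF that] has_delta_deriv_const]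
        has_delta_deriv_affine] by (simp add: \<eta>_def D_def)
  have \<eta>0: "\<eta> a = 0" "\<eta> b = 0"
    using a_less_b by (simp_all add: \<eta>_def c_def)
  obtain Q where Q: "\<And>t. t \<in> K \<Longrightarrow> has_delta_deriv T Q (D t \<bullet> D t) t"
    using rd_continuous_antiderivative[OF rd_continuous_on_inner[OF D D]] by blast
  define H where "H = (\<lambda>t. P t \<bullet> \<eta> t + Q t + c \<bullet> \<eta> t)"
  have "has_delta_deriv T H (?p t \<bullet> \<eta> (\<sigma> t) + ?q t \<bullet> D t) t" if t: "t \<in> K" for t
  proof -
    have "has_delta_deriv T H
        ((?p t \<bullet> \<eta> (\<sigma> t) + P t \<bullet> D t) + D t \<bullet> D t + (0 \<bullet> \<eta> (\<sigma> t) + c \<bullet> D t)) t"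
      unfolding H_def
      by (intro has_delta_deriv_add has_delta_deriv_inner has_delta_deriv_const P Q \<eta> t)
    moreover have "(?p t \<bullet> \<eta> (\<sigma> t) + P t \<bullet> D t) + D t \<bullet> D t + (0 \<bullet> \<eta> (\<sigma> t) + c \<bullet> D t)
        = ?p t \<bullet> \<eta> (\<sigma> t) + (P t + D t + c) \<bullet> D t"
      by (simp add: inner_add_left)
    moreover have "P t + D t + c = ?q t" by (simp add: D_def)
    ultimately show ?thesis by (simp add: add.assoc)
  qed
  from first_variation[OF C2 gw gv min \<eta> D _ _ this] have "H a = H b" by (simp add: \<eta>0)
  then have "Q a = Q b" by (simp add: H_def \<eta>0)
  from nonneg_deriv_equal_ends_imp_zero[OF Q inner_ge_zero this] have "D t = 0" if "t \<in> K" for t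
    using that by simp
  then have "?q t = P t + c" if "t \<in> K" for t
    using that by (simp add: D_def algebra_simps)
  moreover have "has_delta_deriv T (\<lambda>t. P t + c) (?p t) t" if "t \<in> K" for t
    using has_delta_deriv_add[OF P[OF that] has_delta_deriv_const] by simp
  ultimately show ?thesis using that by blast
qed

text \<open>With \<open>q = P\<close>, the product rule makes \<open>P \<bullet> \<eta>\<close> an antiderivative for the first variation. Affine variations that
  vanish at one end isolate the value of \<open>P\<close> at the other.\<close>

lemma natural_boundary_values:
  fixes L :: "'n::finite lagrangian"
  assumes C2: "\<And>t. t \<in> T \<Longrightarrow> class_C2 (\<lambda>(w, v). L t w v)"
    and gw: "jointly_rd_continuous T (grad_w L)" and gv: "jointly_rd_continuous T (grad_v L)"
    and min: "weak_local_minimizer T a b L ya yb y"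
    and P: "\<And>t. t \<in> K \<Longrightarrow> has_delta_deriv T P (along T (grad_w L) y t) t"
      "\<And>t. t \<in> K \<Longrightarrow> along T (grad_v L) y t = P t"
  shows "ya = None \<Longrightarrow> P a = 0" and "yb = None \<Longrightarrow> P b = 0"
proof -
  have *: "P a \<bullet> ((a - c) *\<^sub>R v) = P b \<bullet> ((b - c) *\<^sub>R v)"
    if "ya \<noteq> None \<Longrightarrow> a = c" "yb \<noteq> None \<Longrightarrow> b = c" for c v
  proof (rule first_variation[OF C2 gw gv min has_delta_deriv_affine rd_continuous_on_const])
    show "has_delta_deriv T (\<lambda>t. P t \<bullet> ((t - c) *\<^sub>R v))
      (along T (grad_w L) y t \<bullet> ((\<sigma> t - c) *\<^sub>R v) + along T (grad_v L) y t \<bullet> v) t" if "t \<in> K" for t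
      using has_delta_deriv_inner[OF P(1)[OF that] has_delta_deriv_affine that] P(2)[OF that] by simp
  qed (use that in auto)
  \<comment> \<open>The affine variation \<open>(t - b) *\<^sub>R P a\<close> vanishes at \<open>b\<close> and is a multiple of \<open>P a\<close> at \<open>a\<close>.\<close>
  from *[of b "P a"] show "ya = None \<Longrightarrow> P a = 0" using a_less_b by simp
  from *[of a "P b"] show "yb = None \<Longrightarrow> P b = 0" using a_less_b by simp
qed

text \<open>Two functions that agree on \<open>kappa T\<close> may differ at an isolated maximum. That point does not enter the
  derivative at \<open>t\<close> if \<open>\<sigma> t\<close> is not the maximum: it is then at a positive distance from \<open>t\<close>.\<close>

lemma has_delta_deriv_cong_kappa:
  assumes P: "has_delta_deriv T P D t" and eq: "\<And>s. s \<in> K \<Longrightarrow> f s = P s"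
    and t: "\<sigma> t \<in> K"
  shows "has_delta_deriv T f D t"
proof (rule has_delta_derivI)
  fix e :: real assume "0 < e"
  then obtain d where d: "0 < d" "\<And>s. s \<in> T \<Longrightarrow> \<bar>s - t\<bar> < d \<Longrightarrow>
     norm (P (\<sigma> t) - P s - (\<sigma> t - s) *\<^sub>R D) \<le> e * \<bar>\<sigma> t - s\<bar>"
    using has_delta_derivD[OF P] by blast
  define d' where "d' = (if b \<in> K then d else min d (b - t))"
  \<comment> \<open>If \<open>b\<close> is isolated, then \<open>t \<le> \<sigma> t < b\<close> leaves room for a neighbourhood of \<open>t\<close> that avoids \<open>b\<close>.\<close>
  have "t < b" if "b \<notin> K"
    using that t fwd_jump_ge[of t] T_sub by (force simp: in_kappa_iff)
  then have "0 < d'" using d(1) by (simp add: d'_def)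
  moreover have "s \<in> K" if "s \<in> T" "\<bar>s - t\<bar> < d'" for s
  proof (cases "s = b")
    case False
    with that(1) T_sub have "s < b" by force
    with that(1) show ?thesis by (rule in_kappaI)
  qed (use that in \<open>auto simp: d'_def split: if_splits\<close>)
  ultimately show "\<exists>d>0. \<forall>s\<in>T. \<bar>s - t\<bar> < d \<longrightarrow>
     norm (f (\<sigma> t) - f s - (\<sigma> t - s) *\<^sub>R D) \<le> e * \<bar>\<sigma> t - s\<bar>"
    using d(2) eq t by (intro exI[of _ d']) (auto simp: d'_def split: if_splits)
qed

end

theorem corollary1:
  fixes T0 T :: "real set" and a b :: real
    and L :: "'n::finite lagrangian"
    and ya yb :: "(real ^ 'n) option"
    and ystar :: "real \<Rightarrow> real ^ 'n"
  assumes "time_scale T0" and "a < b" and "T = {a..b} \<inter> T0" and "a \<in> T" and "b \<in> T"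
    and "infinite T \<or> card T \<ge> 3"
    and "\<forall>t\<in>T. class_C2 (\<lambda>(w, v). L t w v)"
    and "jointly_rd_continuous T (grad_w L)" and "jointly_rd_continuous T (grad_v L)"
    and "weak_local_minimizer T a b L ya yb ystar"
  shows "(\<forall>t \<in> kappa (kappa T). fwd_jump T t \<in> kappa T \<longrightarrow>
            has_delta_deriv T (along T (grad_v L) ystar) (along T (grad_w L) ystar t) t) \<and>
         (ya = None \<longrightarrow> along T (grad_v L) ystar a = 0) \<and>
         (yb = None \<longrightarrow>
            graininess T (bwd_jump T b) *\<^sub>R along T (grad_w L) ystar (bwd_jump T b)
              + along T (grad_v L) ystar (bwd_jump T b) = 0)"
proof -
  interpret compact_time_scale T a b
    using assms by unfold_locales (auto simp: time_scale_def intro: closed_Int)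
  have C2: "\<And>t. t \<in> T \<Longrightarrow> class_C2 (\<lambda>(w, v). L t w v)" using assms by blast
  obtain P where P: "\<And>t. t \<in> kappa T \<Longrightarrow> has_delta_deriv T P (along T (grad_w L) ystar t) t"
      "\<And>t. t \<in> kappa T \<Longrightarrow> along T (grad_v L) ystar t = P t"
    using du_bois_reymond[OF C2 assms(8,9,10)] by blast
  note nat_bc = natural_boundary_values[OF C2 assms(8,9,10) P]
  let ?r = "bwd_jump T b"
  show ?thesis
  proof (intro conjI ballI impI)
    fix t assume "t \<in> kappa (kappa T)" "fwd_jump T t \<in> kappa T"
    moreover from this(1) have "t \<in> kappa T" by (simp add: kappa_def[of "kappa T"])
    ultimately show "has_delta_deriv T (along T (grad_v L) ystar) (along T (grad_w L) ystar t) t"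
      using has_delta_deriv_cong_kappa P by blast
  next
    assume "ya = None"
    then show "along T (grad_v L) ystar a = 0"
      using nat_bc(1) P(2)[OF a_in_kappa] by simp
  next
    assume "yb = None"
    have "P b = P ?r + graininess T ?r *\<^sub>R along T (grad_w L) ystar ?r"
      using delta_deriv_fwd_jump[OF P(1) bwd_jump_b_in_kappa] bwd_jump_b_in_kappa
      by (simp add: fwd_jump_bwd_jump_b graininess_def)
    moreover have "P b = 0" using nat_bc(2) \<open>yb = None\<close> by simp
    ultimately show "graininess T ?r *\<^sub>R along T (grad_w L) ystar ?r + along T (grad_v L) ystar ?r = 0"
      using P(2)[OF bwd_jump_b_in_kappa] by (simp add: add.commute)
  qed
qed

end
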